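(* Define $$f(\alpha) = \begin{cases} \dfrac{\alpha+1}{4} & \text{for very simple increasing trees},\\[2mm] \dfrac{2\alpha+1}{4(\alpha+1)} & \text{for shape exchangeable trees.}\end{cases}$$ Then for the broadcasting process with bit-flipping probability $q\in[0,1]$ on a very simple increasing tree or on a shape exchangeable tree, with any parameter $\alpha$ allowed in the respective model, it holds that if $q \ge f(\alpha)$, then $$R_{\mathrm{maj}}(q) = \frac12 .$$
   Context: **Growing trees.** A growing random tree is a sequence $(T_n)_{n\ge 1}$ where $T_1$ is the single vertex $1$ (the root) and $T_{n+1}$ is obtained from $T_n$ by attaching the new vertex $n+1$ by one edge to a random vertex $v\in\{1,\dots,n\}$ (the parent of $n+1$), chosen according to a distribution depending only on $T_n$; write $n+1\sim v$ for this event. Let $\deg_n(v)$ be the degree of $v$ in $T_n$, and $\deg_n^+(v)$ its outdegree, i.e. the number of neighbours of $v$ in $T_n$ with a larger label (children). *Very simple increasing tree* with parameter $\alpha\in\{-1/d : d\in\mathbb N, d>1\}\cup[0,\infty)$: for all $v\in\{1,\dots,n\}$, $$\mathbb P(n+1\sim v\mid T_n)=\frac{\alpha\deg_n^+(v)+1}{\alpha(n-1)+n}.$$ *Shape exchangeable tree* with parameter $\alpha\in\{-1/d : d\in\mathbb N, d>2\}\cup[0,\infty)$: for all $v\in\{1,\dots,n\}$, $$\mathbb P(n+1\sim v\mid T_n)=\frac{\alpha\deg_n(v)+1}{2\alpha(n-1)+n}.$$ **Broadcasting process** with bit-flipping probability $q$: every vertex $u$ carries a color $B_u\in\{-1,1\}$.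 The root color $B_1$ is chosen uniformly at random. When vertex $n+1$ arrives, it first chooses its parent $p_{n+1}$ according to the attachment distribution given by $T_n$; then $B_{n+1}=B_{p_{n+1}}$ with probability $1-q$ and $B_{n+1}=-B_{p_{n+1}}$ with probability $q$, independently of all other vertices and their colors. **Majority estimator**: $b_{\mathrm{maj}}(N,q)=\operatorname{sgn}\big(\sum_{u\in T_N}B_u\big)$ if $\sum_{u\in T_N}B_u\ne 0$, and otherwise $b_{\mathrm{maj}}(N,q)$ is an independent random variable that is uniform on $\{-1,1\}$. **Error probability**: $R_{\mathrm{maj}}(N,q)=\mathbb P(b_{\mathrm{maj}}(N,q)\ne B_1)$ and $R_{\mathrm{maj}}(q)=\limsup_{N\to\infty}R_{\mathrm{maj}}(N,q)$. *)

theory Defs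
  imports "HOL-Probability.Probability"
begin

text \<open>A tree on the vertices \<open>1, \<dots>, n\<close> rooted at \<open>1\<close> is represented by its parent function: the edges
  join \<open>u\<close> and \<open>p u\<close> for \<open>2 \<le> u \<le> n\<close>. Values of \<open>p\<close> outside \<open>{2..n}\<close> are irrelevant.\<close>

definition adj :: "nat \<Rightarrow> (nat \<Rightarrow> nat) \<Rightarrow> nat \<Rightarrow> nat \<Rightarrow> bool" where
  "adj n p u v \<longleftrightarrow> u \<in> {1..n} \<and> v \<in> {1..n} \<and> (2 \<le> u \<and> p u = v \<or> 2 \<le> v \<and> p v = u)"

definition deg :: "nat \<Rightarrow> (nat \<Rightarrow> nat) \<Rightarrow> nat \<Rightarrow> nat" where
  "deg n p v = card {u. adj n p u v}"

definition outdeg :: "nat \<Rightarrow> (nat \<Rightarrow> nat) \<Rightarrow> nat \<Rightarrow> nat" where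
  "outdeg n p v = card {u. adj n p u v \<and> v < u}"

datatype tree_model = Very_Simple_Increasing | Shape_Exchangeable

fun allowed_params :: "tree_model \<Rightarrow> real set" where
  "allowed_params Very_Simple_Increasing = {- 1 / real d | d. d > 1} \<union> {0..}"
| "allowed_params Shape_Exchangeable = {- 1 / real d | d. d > 2} \<union> {0..}"

fun attach_prob :: "tree_model \<Rightarrow> real \<Rightarrow> nat \<Rightarrow> (nat \<Rightarrow> nat) \<Rightarrow> nat \<Rightarrow> real" where
  "attach_prob Very_Simple_Increasing \<alpha> n p v =
     (\<alpha> * real (outdeg n p v) + 1) / (\<alpha> * (real n - 1) + real n)"
| "attach_prob Shape_Exchangeable \<alpha> n p v =
     (\<alpha> * real (deg n p v) + 1) / (2 * \<alpha> * (real n - 1) + real n)"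

text \<open>\<open>embed_pmf\<close> is meaningful only for a probability mass function; by \<open>pmf_attachment\<close> below
  this is the case for every tree that the process reaches with positive probability.\<close>

definition attachment :: "tree_model \<Rightarrow> real \<Rightarrow> nat \<Rightarrow> (nat \<Rightarrow> nat) \<Rightarrow> nat pmf" where
  "attachment m \<alpha> n p = embed_pmf (\<lambda>v. if v \<in> {1..n} then attach_prob m \<alpha> n p v else 0)"

text \<open>Joint law of the tree \<open>T\<^sub>n\<close> (as a parent function) and of the colors of its vertices. The
  equation for \<open>0\<close> is a dummy, as is the value \<open>0\<close> of both functions outside their range.\<close>

fun broadcast :: "tree_model \<Rightarrow> real \<Rightarrow> real \<Rightarrow> nat \<Rightarrow> ((nat \<Rightarrow> nat) \<times> (nat \<Rightarrow> int)) pmf" where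
  "broadcast m \<alpha> q 0 = return_pmf (\<lambda>_. 0, \<lambda>_. 0)"
| "broadcast m \<alpha> q (Suc 0) =
     do {
       b \<leftarrow> pmf_of_set {-1, 1};
       return_pmf (\<lambda>_. 0, (\<lambda>_. 0)(1 := b))
     }"
| "broadcast m \<alpha> q (Suc (Suc n)) =
     do {
       (p, B) \<leftarrow> broadcast m \<alpha> q (Suc n);
       v \<leftarrow> attachment m \<alpha> (Suc n) p;
       flip \<leftarrow> bernoulli_pmf q;
       return_pmf (p(Suc (Suc n) := v), B(Suc (Suc n) := (if flip then - B v else B v)))
     }"

text \<open>Joint law of the majority estimator and of the root color.\<close>

definition majority :: "tree_model \<Rightarrow> real \<Rightarrow> real \<Rightarrow> nat \<Rightarrow> (int \<times> int) pmf" where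
  "majority m \<alpha> q N =
     do {
       (p, B) \<leftarrow> broadcast m \<alpha> q N;
       tie \<leftarrow> pmf_of_set {-1, 1};
       let S = (\<Sum>u\<in>{1..N}. B u);
       return_pmf (if S \<noteq> 0 then sgn S else tie, B 1)
     }"

definition R_maj_at :: "tree_model \<Rightarrow> real \<Rightarrow> nat \<Rightarrow> real \<Rightarrow> real" where
  "R_maj_at m \<alpha> N q = measure_pmf.prob (majority m \<alpha> q N) {(b, root). b \<noteq> root}"

definition R_maj :: "tree_model \<Rightarrow> real \<Rightarrow> real \<Rightarrow> ereal" where
  "R_maj m \<alpha> q = limsup (\<lambda>N. ereal (R_maj_at m \<alpha> N q))"

fun threshold :: "tree_model \<Rightarrow> real \<Rightarrow> real" where
  "threshold Very_Simple_Increasing \<alpha> = (\<alpha> + 1) / 4"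
| "threshold Shape_Exchangeable \<alpha> = (2 * \<alpha> + 1) / (4 * (\<alpha> + 1))"

definition is_tree :: "nat \<Rightarrow> (nat \<Rightarrow> nat) \<Rightarrow> bool" where
  "is_tree n p \<longleftrightarrow> (\<forall>u\<in>{2..n}. p u \<in> {1..<u})"

lemma outdeg_eq:
  assumes "is_tree n p" "v \<in> {1..n}"
  shows "outdeg n p v = card {u \<in> {2..n}. p u = v}"
proof -
  have lt: "p u < u" if "2 \<le> u" "u \<le> n" for u
    using assms that by (auto simp: is_tree_def)
  have "{u. adj n p u v \<and> v < u} = {u \<in> {2..n}. p u = v}"
    using assms(2) by (auto simp: adj_def dest: lt)
  thus ?thesis by (simp add: outdeg_def)
qed

lemma deg_eq:
  assumes "is_tree n p" "v \<in> {1..n}"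
  shows "deg n p v = outdeg n p v + (if v = 1 then 0 else 1)"
proof (cases "v = 1")
  case True
  have "{u. adj n p u v} = {u. adj n p u v \<and> v < u}"
    using True assms(1) by (force simp: adj_def is_tree_def)
  thus ?thesis using True by (simp add: deg_def outdeg_def)
next
  case False
  have fin: "finite {u. adj n p u v \<and> v < u}"
    by (rule finite_subset[of _ "{1..n}"]) (auto simp: adj_def)
  have pv: "p v \<in> {1..<v}" using assms False by (auto simp: is_tree_def)
  have lt: "p u < u" if "2 \<le> u" "u \<le> n" for u
    using assms that by (auto simp: is_tree_def)
  have "{u. adj n p u v} = insert (p v) {u. adj n p u v \<and> v < u}"
    using pv assms False by (auto simp: adj_def dest: lt)
  moreover have "p v \<notin> {u. adj n p u v \<and> v < u}" using pv by auto
  ultimately show ?thesis using False fin by (simp add: deg_def outdeg_def)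
qed

lemma sum_outdeg:
  assumes "is_tree n p" "n \<ge> 1"
  shows "(\<Sum>v\<in>{1..n}. outdeg n p v) = n - 1"
proof -
  have "(\<Sum>v\<in>{1..n}. outdeg n p v) = (\<Sum>v\<in>{1..n}. card {u \<in> {2..n}. p u = v})"
    using assms(1) by (intro sum.cong refl outdeg_eq)
  also have "\<dots> = card {2..n}"
    unfolding card_eq_sum
  proof (rule sum.group)
    show "p ` {2..n} \<subseteq> {1..n}"
    proof (rule image_subsetI)
      fix u assume u: "u \<in> {2..n}"
      hence "p u \<in> {1..<u}" using assms(1) by (simp add: is_tree_def)
      thus "p u \<in> {1..n}" using u by simp
    qed
  qed simp_all
  finally show ?thesis by simp
qed

lemma sum_deg:
  assumes "is_tree n p" "n \<ge> 1"
  shows "(\<Sum>v\<in>{1..n}. deg n p v) = 2 * (n - 1)"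
proof -
  have "(\<Sum>v\<in>{1..n}. deg n p v) = (\<Sum>v\<in>{1..n}. outdeg n p v + (if v = 1 then 0 else 1))"
    using assms(1) by (intro sum.cong refl deg_eq)
  also have "\<dots> = (n - 1) + (\<Sum>v\<in>{1..n}. if v = 1 then 0 else 1)"
    by (simp only: sum.distrib sum_outdeg[OF assms])
  also have "(\<Sum>v\<in>{1..n}. if v = 1 then 0 else (1::nat)) = n - 1"
    using assms(2) by (subst sum.remove[of _ 1]) auto
  finally show ?thesis by simp
qed

lemma allowed_cases:
  assumes "\<alpha> \<in> allowed_params m"
  obtains "\<alpha> \<ge> 0" | d where "\<alpha> = - 1 / real d" "d \<ge> 2" "m = Shape_Exchangeable \<Longrightarrow> d \<ge> 3"
  using assms by (cases m) fastforce+

lemma denom_pos: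
  assumes "\<alpha> \<in> allowed_params m" "n \<ge> 1"
  shows "\<alpha> * (real n - 1) + real n > 0"
    and "m = Shape_Exchangeable \<Longrightarrow> 2 * \<alpha> * (real n - 1) + real n > 0"
proof -
  have *: "c * (real n - 1) + real n > 0" if "c > -1" for c :: real
  proof -
    have "c * (real n - 1) \<ge> (-1) * (real n - 1)"
      using assms(2) that by (intro mult_right_mono) auto
    thus ?thesis by (simp add: algebra_simps)
  qed
  have "\<alpha> > -1" using assms(1)
    by (rule allowed_cases) (auto simp: divide_less_eq_1)
  thus "\<alpha> * (real n - 1) + real n > 0" by (rule *)
  assume m: "m = Shape_Exchangeable"
  have "2 * \<alpha> > -1" using assms(1)
    by (rule allowed_cases) (use m in \<open>auto simp: divide_less_eq\<close>)
  thus "2 * \<alpha> * (real n - 1) + real n > 0" by (rule *)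
qed

lemma sum_attach_prob:
  assumes "\<alpha> \<in> allowed_params m" "n \<ge> 1" "is_tree n p"
  shows "(\<Sum>v\<in>{1..n}. attach_prob m \<alpha> n p v) = 1"
proof (cases m)
  case Very_Simple_Increasing
  have "(\<Sum>v\<in>{1..n}. \<alpha> * real (outdeg n p v) + 1) = \<alpha> * real (\<Sum>v\<in>{1..n}. outdeg n p v) + real n"
    by (simp add: sum.distrib sum_distrib_left)
  also have "\<dots> = \<alpha> * (real n - 1) + real n"
    unfolding sum_outdeg[OF assms(3,2)] using assms(2) by (simp add: of_nat_diff)
  finally show ?thesis using denom_pos(1)[OF assms(1,2)] Very_Simple_Increasing
    by (simp add: sum_divide_distrib[symmetric])
next
  case Shape_Exchangeable
  have "(\<Sum>v\<in>{1..n}. \<alpha> * real (deg n p v) + 1) = \<alpha> * real (\<Sum>v\<in>{1..n}. deg n p v) + real n"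
    by (simp add: sum.distrib sum_distrib_left)
  also have "\<dots> = 2 * \<alpha> * (real n - 1) + real n"
    unfolding sum_deg[OF assms(3,2)] using assms(2) by (simp add: of_nat_diff)
  finally show ?thesis using denom_pos(2)[OF assms(1,2)] Shape_Exchangeable
    by (simp add: sum_divide_distrib[symmetric])
qed

definition attachable :: "tree_model \<Rightarrow> real \<Rightarrow> nat \<Rightarrow> (nat \<Rightarrow> nat) \<Rightarrow> bool" where
  "attachable m \<alpha> n p \<longleftrightarrow> is_tree n p \<and> (\<forall>v\<in>{1..n}. attach_prob m \<alpha> n p v \<ge> 0)"

lemma pmf_attachment_aux:
  assumes "\<alpha> \<in> allowed_params m" "n \<ge> 1" "attachable m \<alpha> n p"
  shows "pmf (attachment m \<alpha> n p) v = (if v \<in> {1..n} then attach_prob m \<alpha> n p v else 0)"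
  unfolding attachment_def
proof (rule pmf_embed_pmf)
  show "0 \<le> (if v \<in> {1..n} then attach_prob m \<alpha> n p v else 0)" for v
    using assms(3) by (auto simp: attachable_def)
  have "(\<integral>\<^sup>+v. ennreal (if v \<in> {1..n} then attach_prob m \<alpha> n p v else 0) \<partial>count_space UNIV)
      = (\<Sum>v\<in>{1..n}. ennreal (if v \<in> {1..n} then attach_prob m \<alpha> n p v else 0))"
    by (rule nn_integral_count_space'[OF finite_atLeastAtMost]) auto
  also have "\<dots> = (\<Sum>v\<in>{1..n}. ennreal (attach_prob m \<alpha> n p v))" by simp
  also have "\<dots> = ennreal (\<Sum>v\<in>{1..n}. attach_prob m \<alpha> n p v)"
    using assms(3) by (intro sum_ennreal) (auto simp: attachable_def)
  also have "\<dots> = 1" using sum_attach_prob[OF assms(1,2)] assms(3) by (simp add: attachable_def)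
  finally show "(\<integral>\<^sup>+v. ennreal (if v \<in> {1..n} then attach_prob m \<alpha> n p v else 0) \<partial>count_space UNIV) = 1" .
qed

lemma is_tree_step:
  assumes "is_tree n p" "v \<in> {1..n}"
  shows "is_tree (Suc n) (p(Suc n := v))"
  using assms by (auto simp: is_tree_def)

lemma outdeg_step:
  assumes "is_tree n p" "v \<in> {1..n}" "w \<in> {1..Suc n}"
  shows "outdeg (Suc n) (p(Suc n := v)) w =
    (if w = Suc n then 0 else outdeg n p w + (if w = v then 1 else 0))"
proof -
  let ?p = "p(Suc n := v)"
  have o: "outdeg (Suc n) ?p w = card {u \<in> {2..Suc n}. ?p u = w}"
    by (rule outdeg_eq[OF is_tree_step[OF assms(1,2)] assms(3)])
  show ?thesis
  proof (cases "w = Suc n")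
    case True
    have "?p u < Suc n" if "u \<in> {2..Suc n}" for u
    proof (cases "u = Suc n")
      case False
      hence "u \<in> {2..n}" using that by auto
      hence "p u \<in> {1..<u}" using assms(1) by (simp add: is_tree_def)
      thus ?thesis using False that by simp
    qed (use assms(2) in auto)
    hence "{u \<in> {2..Suc n}. ?p u = w} = {}"
      using True by fastforce
    thus ?thesis using o True by simp
  next
    case False
    have "{u \<in> {2..Suc n}. ?p u = w} = {u \<in> {2..n}. p u = w} \<union> (if w = v then {Suc n} else {})"
      using assms False by auto
    thus ?thesis using o False assms outdeg_eq[OF assms(1), of w]
      by (auto simp: card_insert_if)
  qed
qed

lemma weight_step:
  fixes k :: nat
  assumes "\<alpha> \<in> allowed_params m" "\<alpha> * real k + 1 > 0"
  shows "\<alpha> * real (Suc k) + 1 \<ge> 0"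
  using assms(1)
proof (rule allowed_cases)
  fix d :: nat assume d: "\<alpha> = - 1 / real d" "d \<ge> 2"
  have "real k < real d" using assms(2) d by (simp add: field_simps)
  hence "real (Suc k) \<le> real d" by simp
  hence "real (Suc k) / real d \<le> 1" using d(2) by (simp del: of_nat_Suc)
  thus ?thesis using d(1) by (simp del: of_nat_Suc)
qed auto

lemma attachable_step:
  assumes a: "\<alpha> \<in> allowed_params m" and n: "n \<ge> 1" and p: "attachable m \<alpha> n p"
    and v: "v \<in> set_pmf (attachment m \<alpha> n p)"
  shows "attachable m \<alpha> (Suc n) (p(Suc n := v))"
proof -
  have t: "is_tree n p" using p by (simp add: attachable_def)
  from v have "pmf (attachment m \<alpha> n p) v \<noteq> 0" by (simp add: set_pmf_iff)
  hence v: "v \<in> {1..n}" and ne: "attach_prob m \<alpha> n p v \<noteq> 0"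
    using pmf_attachment_aux[OF a n p, of v] by (auto split: if_splits)
  have pos: "attach_prob m \<alpha> n p v > 0"
    using ne p v by (force simp: attachable_def)
  let ?p = "p(Suc n := v)"
  have t': "is_tree (Suc n) ?p" by (rule is_tree_step[OF t v])
  have "\<alpha> \<ge> -1" using denom_pos(1)[OF a, of 2] weight_step[OF a, of 0] by simp
  have "attach_prob m \<alpha> (Suc n) ?p w \<ge> 0" if w: "w \<in> {1..Suc n}" for w
  proof (cases m)
    case Very_Simple_Increasing
    note d1 = denom_pos(1)[OF a n] and d2 = denom_pos(1)[OF a, of "Suc n"]
    have "\<alpha> * real (outdeg (Suc n) ?p w) + 1 \<ge> 0"
    proof (cases "w = Suc n")
      case True thus ?thesis using outdeg_step[OF t v w] by simp
    next
      case False
      hence wn: "w \<in> {1..n}" using w by auto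
      have "\<alpha> * real (outdeg n p w) + 1 \<ge> 0"
        using p wn Very_Simple_Increasing d1 unfolding attachable_def
        by (auto simp: zero_le_divide_iff)
      moreover have "\<alpha> * real (outdeg n p v) + 1 > 0"
        using pos d1 Very_Simple_Increasing by (simp add: zero_less_divide_iff)
      ultimately show ?thesis
        using weight_step[OF a, of "outdeg n p v"] outdeg_step[OF t v w] False by (simp add: add.commute)
    qed
    thus ?thesis using d2 Very_Simple_Increasing by (simp add: zero_le_divide_iff)
  next
    case Shape_Exchangeable
    note d1 = denom_pos(2)[OF a n Shape_Exchangeable]
      and d2 = denom_pos(2)[OF a _ Shape_Exchangeable, of "Suc n"]
    have "\<alpha> * real (deg (Suc n) ?p w) + 1 \<ge> 0"
    proof (cases "w = Suc n")
      case True thus ?thesis using outdeg_step[OF t v w] deg_eq[OF t' w] n \<open>\<alpha> \<ge> -1\<close> by simp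
    next
      case False
      hence wn: "w \<in> {1..n}" using w by auto
      have eq: "deg (Suc n) ?p w = deg n p w + (if w = v then 1 else 0)"
        using outdeg_step[OF t v w] deg_eq[OF t' w] deg_eq[OF t wn] False by simp
      have "\<alpha> * real (deg n p w) + 1 \<ge> 0"
        using p wn Shape_Exchangeable d1 unfolding attachable_def
        by (auto simp: zero_le_divide_iff)
      moreover have "\<alpha> * real (deg n p v) + 1 > 0"
        using pos d1 Shape_Exchangeable by (simp add: zero_less_divide_iff)
      ultimately show ?thesis
        using weight_step[OF a, of "deg n p v"] eq by (simp add: add.commute)
    qed
    thus ?thesis using d2 Shape_Exchangeable by (simp add: zero_le_divide_iff)
  qed
  thus ?thesis using t' by (simp add: attachable_def)
qed

lemma attachable_broadcast:
  assumes "\<alpha> \<in> allowed_params m" "n \<ge> 1" "(p, B) \<in> set_pmf (broadcast m \<alpha> q n)"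
  shows "attachable m \<alpha> n p"
  using assms(2,3)
proof (induction n arbitrary: p B rule: nat_induct_at_least)
  case base
  show ?case
    by (cases m) (auto simp: attachable_def is_tree_def outdeg_def deg_def adj_def)
next
  case (Suc n)
  then obtain k where k: "n = Suc k" by (cases n) auto
  from Suc.prems obtain p' B' v where "(p', B') \<in> set_pmf (broadcast m \<alpha> q n)"
    "v \<in> set_pmf (attachment m \<alpha> n p')" "p = p'(Suc n := v)"
    unfolding k by (auto simp: set_bind_pmf)
  thus ?case using attachable_step[OF assms(1) Suc.hyps Suc.IH] by blast
qed

lemma pmf_attachment:
  assumes "\<alpha> \<in> allowed_params m" "n \<ge> 1" "(p, B) \<in> set_pmf (broadcast m \<alpha> q n)"
  shows "pmf (attachment m \<alpha> n p) v = (if v \<in> {1..n} then attach_prob m \<alpha> n p v else 0)"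
  using pmf_attachment_aux[OF assms(1,2) attachable_broadcast[OF assms]] .

end

theory Submission
  imports Defs "HOL-Real_Asymp.Real_Asymp"
begin

text \<open>The attachment probabilities are affine in the degree, so two numbers carry all the information
that matters for the majority vote: the sum \<open>y\<close> of the colors and the sum \<open>w\<close> of the colors weighted
by the attachment weights of their vertices, both multiplied by the root color. A new vertex picks a
parent with the root color with probability \<open>(1 + w / D n) / 2\<close>, where \<open>D n\<close> is the total weight of
the tree. If \<open>b = \<plusminus>1\<close> tells whether the parent has the root color and \<open>s = \<plusminus>1\<close> whether the child
keeps the color of its parent, then \<open>y\<close> grows by \<open>s * b\<close> and \<open>w\<close> grows by \<open>(\<alpha> + \<beta> * s) * b\<close>: the parent
gains the weight \<open>\<alpha>\<close>, and the child enters with the weight \<open>\<beta>\<close>, which is \<open>1\<close> in a very simple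
increasing tree and \<open>\<alpha> + 1\<close> in a shape exchangeable tree. Hence \<open>(y, w)\<close> is a Markov chain, a
two-color urn started at \<open>(1, 1)\<close>, and the error probability of the majority estimator is
\<open>(\<P>(y < 0) + \<P>(y \<le> 0)) / 2\<close>.

In the mean, \<open>w\<close> is multiplied by \<open>1 + \<rho> / D n\<close> in each step, with \<open>\<rho> = \<alpha> + \<beta> * (1 - 2 * q)\<close>, while
\<open>D n\<close> grows linearly with slope \<open>\<gamma> = \<alpha> + \<beta>\<close>. The influence of the start on \<open>y\<close> therefore has
order at most \<open>n powr (\<rho> / \<gamma>)\<close>, or is at most logarithmic if \<open>\<rho> \<le> 0\<close>, whereas the fluctuations have
order at least \<open>sqrt n\<close>. The condition \<open>q \<ge> threshold m \<alpha>\<close> is exactly \<open>2 * \<rho> \<le> \<gamma>\<close>: the influence of the start does not outgrow \<open>sqrt n\<close>. In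
the boundary case \<open>2 * \<rho> = \<gamma>\<close> the fluctuations win by a logarithmic factor. So \<open>y\<close>, suitably
normalised, converges to a centred normal law, which no longer remembers the root color, and both probabilities above tend to \<open>1 / 2\<close>.

The central limit theorem is proved with characteristic functions. The conditional expectation of
the final value of \<open>y\<close> given the chain at time \<open>k\<close> is a linear function of the state, and this
martingale starts at a deterministic value. The conditional variance of its increment is a
deterministic number, up to a relative error of at most \<open>(w / D k)\<^sup>2\<close>, whose mean tends to zero
(\<open>rel_moment_tendsto_0\<close>). Hence the characteristic function can be compared with a Gaussian one
increment by increment (\<open>char_telescope\<close>), and the comparison is good as soon as every single
coefficient of the martingale is small compared with the total standard deviation (\<open>char_tendsto\<close>).
The condition \<open>2 * \<rho> \<le> \<gamma>\<close> yields this smallness (\<open>negligible\<close>) as well as the vanishing of the mean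
of \<open>(w / D k)\<^sup>2\<close>.\<close>

section \<open>Two analytic lemmas\<close>

lemma exp_minus_approx:
  assumes "(u::real) \<ge> 0"
  shows "\<bar>exp (- u) - (1 - u)\<bar> \<le> u\<^sup>2 / 2"
proof -
  have "1 - u \<le> exp (-u)" using exp_ge_add_one_self[of "-u"] by simp
  moreover have "exp (-u) \<le> 1 - u + u\<^sup>2/2"
  proof -
    let ?P = "1 - u + u\<^sup>2 / 2"
    have "1 \<le> (1 + u + u\<^sup>2 / 2) * ?P"
      using assms by (simp add: algebra_simps power2_eq_square)
    also have "\<dots> \<le> exp u * ?P"
    proof (rule mult_right_mono)
      show "1 + u + u\<^sup>2 / 2 \<le> exp u" using exp_lower_Taylor_quadratic[OF assms] .
      show "0 \<le> ?P" using zero_le_power2[of "1 - u"] by (simp add: power2_diff)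
    qed
    finally show ?thesis by (simp add: exp_minus field_simps)
  qed
  ultimately show ?thesis by simp
qed

text \<open>Second order Taylor expansion of the characteristic function of a centred variable, compared with a
Gaussian one. The variance \<open>V\<close> of the Gaussian may differ from the variance \<open>s\<close> of the variable: the
conditional variances in the martingale below are random, and they are replaced by deterministic ones.\<close>

lemma pmf_char_approx:
  fixes K :: "'a pmf" and X :: "'a \<Rightarrow> real"
  assumes fin: "finite (set_pmf K)"
    and mean: "measure_pmf.expectation K X = 0"
    and bound: "\<And>x. x \<in> set_pmf K \<Longrightarrow> \<bar>X x\<bar> \<le> b"
    and s: "measure_pmf.expectation K (\<lambda>x. (X x)\<^sup>2) = s" and V: "V \<ge> 0"
  shows "cmod (measure_pmf.expectation K (\<lambda>x. iexp (t * X x)) - exp (- (t\<^sup>2 * V / 2)))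
           \<le> \<bar>t\<bar> ^ 3 * b * s / 6 + t\<^sup>2 * \<bar>V - s\<bar> / 2 + t ^ 4 * V\<^sup>2 / 8"
proof -
  note int = integrable_measure_pmf_finite[OF fin]
  let ?E = "measure_pmf.expectation K :: ('a \<Rightarrow> complex) \<Rightarrow> complex"
  let ?g = "\<lambda>x. 1 + \<i> * of_real (t * X x) - of_real ((t * X x)\<^sup>2 / 2) :: complex"
  have g: "?E ?g = of_real (1 - t\<^sup>2 * s / 2)"
  proof -
    have "?E ?g = ?E (\<lambda>x. of_real (1 - t\<^sup>2 / 2 * (X x)\<^sup>2) + \<i> * of_real (t * X x))"
      by (intro Bochner_Integration.integral_cong) (auto simp: power_mult_distrib)
    also have "\<dots> = ?E (\<lambda>x. of_real (1 - t\<^sup>2 / 2 * (X x)\<^sup>2)) + \<i> * ?E (\<lambda>x. of_real (t * X x))"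
      by (subst Bochner_Integration.integral_add) (auto intro!: int)
    also have "\<dots> = of_real (measure_pmf.expectation K (\<lambda>x. 1 - t\<^sup>2 / 2 * (X x)\<^sup>2))
        + \<i> * of_real (measure_pmf.expectation K (\<lambda>x. t * X x))"
      by (simp only: integral_complex_of_real)
    also have "\<dots> = of_real (1 - t\<^sup>2 * s / 2)"
      by (subst Bochner_Integration.integral_diff) (auto intro!: int simp: mean s)
    finally show ?thesis .
  qed
  have point: "cmod (iexp (t * X x) - ?g x) \<le> \<bar>t\<bar> ^ 3 * b / 6 * (X x)\<^sup>2" if "x \<in> set_pmf K" for x
  proof -
    have "cmod (iexp (t * X x) - (\<Sum>k\<le>2. (\<i> * of_real (t * X x)) ^ k / fact k)) \<le> \<bar>t * X x\<bar> ^ 3 / 6"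
      using iexp_approx1[of "t * X x" 2] by (simp add: eval_nat_numeral)
    also have "(\<Sum>k\<le>2. (\<i> * of_real (t * X x)) ^ k / fact k) = ?g x"
      by (simp add: eval_nat_numeral complex_eq_iff)
    also have "\<bar>t * X x\<bar> ^ 3 / 6 = \<bar>t\<bar> ^ 3 / 6 * ((X x)\<^sup>2 * \<bar>X x\<bar>)"
      using power_Suc[of "\<bar>X x\<bar>" 2] by (simp add: abs_mult power_mult_distrib mult_ac)
    also have "\<dots> \<le> \<bar>t\<bar> ^ 3 / 6 * ((X x)\<^sup>2 * b)"
      using bound[OF that] by (intro mult_left_mono) auto
    finally show ?thesis by (simp add: mult_ac)
  qed
  have "cmod (?E (\<lambda>x. iexp (t * X x)) - of_real (1 - t\<^sup>2 * s / 2))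
      = cmod (?E (\<lambda>x. iexp (t * X x) - ?g x))"
    unfolding g[symmetric] by (subst Bochner_Integration.integral_diff[OF int int]) (rule refl)
  also have "\<dots> \<le> measure_pmf.expectation K (\<lambda>x. cmod (iexp (t * X x) - ?g x))"
    by (rule integral_norm_bound)
  also have "\<dots> \<le> measure_pmf.expectation K (\<lambda>x. \<bar>t\<bar> ^ 3 * b / 6 * (X x)\<^sup>2)"
    using point by (intro integral_mono_AE) (auto intro!: int simp: AE_measure_pmf_iff)
  also have "\<dots> = \<bar>t\<bar> ^ 3 * b * s / 6" by (simp add: s)
  finally have 1: "cmod (?E (\<lambda>x. iexp (t * X x)) - of_real (1 - t\<^sup>2 * s / 2)) \<le> \<bar>t\<bar> ^ 3 * b * s / 6" .
  have 2: "cmod (of_real (1 - t\<^sup>2 * s / 2) - of_real (1 - t\<^sup>2 * V / 2)) = t\<^sup>2 * \<bar>V - s\<bar> / 2"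
  proof -
    have "(1 - t\<^sup>2 * s / 2) - (1 - t\<^sup>2 * V / 2) = t\<^sup>2 / 2 * (V - s)" by (simp add: algebra_simps diff_divide_distrib)
    thus ?thesis by (simp only: of_real_diff[symmetric] norm_of_real) (simp add: abs_mult)
  qed
  have 3: "cmod (of_real (1 - t\<^sup>2 * V / 2) - of_real (exp (- (t\<^sup>2 * V / 2)))) \<le> t ^ 4 * V\<^sup>2 / 8"
    using exp_minus_approx[of "t\<^sup>2 * V / 2"] V
    by (simp only: of_real_diff[symmetric] norm_of_real)
       (simp add: abs_minus_commute power_mult_distrib power_divide flip: power_mult)
  have tri: "cmod (u - z) \<le> cmod (u - v) + cmod (v - w) + cmod (w - z)" for u v w z :: complex
    using norm_triangle_ineq[of "u - v" "v - z"] norm_triangle_ineq[of "v - w" "w - z"] by simp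
  show ?thesis
    using tri[of "?E (\<lambda>x. iexp (t * X x))" "of_real (exp (- (t\<^sup>2 * V / 2)))" "of_real (1 - t\<^sup>2 * s / 2)"
        "of_real (1 - t\<^sup>2 * V / 2)"] 1 2 3
    by linarith
qed

text \<open>A weighted average of a null sequence tends to zero if no single weight is a positive fraction of the
total weight: the first terms then carry a vanishing part of the weight, and the others are small.\<close>

lemma weighted_average_tendsto_0:
  fixes v :: "nat \<Rightarrow> nat \<Rightarrow> real" and m :: "nat \<Rightarrow> real"
  assumes v: "\<And>N j. v N j \<ge> 0" and m: "m \<longlonglongrightarrow> 0"
    and pos: "eventually (\<lambda>N. (\<Sum>j\<in>{1..<N}. v N j) > 0) sequentially"
    and bound: "\<And>N j. j \<in> {1..<N} \<Longrightarrow> v N j \<le> b N"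
    and negl: "(\<lambda>N. b N / (\<Sum>j\<in>{1..<N}. v N j)) \<longlonglongrightarrow> 0"
  shows "(\<lambda>N. (\<Sum>j\<in>{1..<N}. v N j * m j) / (\<Sum>j\<in>{1..<N}. v N j)) \<longlonglongrightarrow> 0"
proof (rule tendstoI)
  fix e :: real assume e: "e > 0"
  define S where "S N = (\<Sum>j\<in>{1..<N}. v N j)" for N
  from m e have "eventually (\<lambda>j. \<bar>m j\<bar> < e / 2) sequentially"
    by (auto simp: tendsto_iff dist_real_def dest: spec[of _ "e/2"])
  then obtain J where J: "\<And>j. j \<ge> J \<Longrightarrow> \<bar>m j\<bar> < e / 2" by (auto simp: eventually_sequentially)
  define c where "c = (\<Sum>j<J. \<bar>m j\<bar>)"
  have "(\<lambda>N. c * (b N / S N)) \<longlonglongrightarrow> c * 0"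
    using negl unfolding S_def by (intro tendsto_intros)
  hence "eventually (\<lambda>N. \<bar>c * (b N / S N)\<bar> < e / 2) sequentially"
    using e by (auto simp: tendsto_iff dist_real_def dest: spec[of _ "e/2"])
  moreover have "eventually (\<lambda>N. N \<ge> 2) sequentially" by (rule eventually_ge_at_top)
  ultimately show "eventually (\<lambda>N. dist ((\<Sum>j\<in>{1..<N}. v N j * m j) / (\<Sum>j\<in>{1..<N}. v N j)) 0 < e) sequentially"
    using pos
  proof eventually_elim
    case (elim N)
    have S: "S N > 0" using elim by (simp add: S_def)
    have b: "b N \<ge> 0" using bound[of 1 N] v[of N 1] elim by simp
    have "\<bar>\<Sum>j\<in>{1..<N}. v N j * m j\<bar> \<le> (\<Sum>j\<in>{1..<N}. v N j * \<bar>m j\<bar>)"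
      using v by (intro order_trans[OF sum_abs] sum_mono) (auto simp: abs_mult)
    also have "\<dots> \<le> (\<Sum>j\<in>{1..<N}. (if j < J then b N * \<bar>m j\<bar> else 0) + v N j * (e / 2))"
    proof (rule sum_mono)
      fix j assume j: "j \<in> {1..<N}"
      show "v N j * \<bar>m j\<bar> \<le> (if j < J then b N * \<bar>m j\<bar> else 0) + v N j * (e / 2)"
      proof (cases "j < J")
        case True
        have "v N j * \<bar>m j\<bar> \<le> b N * \<bar>m j\<bar>" using bound[OF j] by (intro mult_right_mono) auto
        moreover have "0 \<le> v N j * (e / 2)" using v e by simp
        ultimately show ?thesis using True by simp
      next
        case False
        thus ?thesis using mult_left_mono[OF less_imp_le[OF J[of j]] v[of N j]] by simp
      qed
    qed
    also have "\<dots> = (\<Sum>j\<in>{1..<N}. if j < J then b N * \<bar>m j\<bar> else 0) + S N * (e / 2)"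
      by (simp add: sum.distrib S_def sum_distrib_right)
    also have "(\<Sum>j\<in>{1..<N}. if j < J then b N * \<bar>m j\<bar> else 0) = (\<Sum>j\<in>{1..<N} \<inter> {..<J}. b N * \<bar>m j\<bar>)"
      by (simp add: sum.inter_restrict)
    also have "\<dots> \<le> (\<Sum>j\<in>{..<J}. b N * \<bar>m j\<bar>)"
      using b by (intro sum_mono2) auto
    also have "\<dots> = c * b N" by (simp add: c_def sum_distrib_left mult.commute)
    finally have "\<bar>\<Sum>j\<in>{1..<N}. v N j * m j\<bar> / S N \<le> (c * b N + S N * (e / 2)) / S N"
      using S by (intro divide_right_mono) auto
    also have "\<dots> = c * (b N / S N) + e / 2" using S by (simp add: add_divide_distrib)
    also have "\<dots> < e" using elim by linarith
    finally show ?case unfolding S_def[symmetric] using S by (simp add: abs_of_pos)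
  qed
qed

section \<open>Two-color urns\<close>

definition spin :: "bool \<Rightarrow> real" where "spin b = (if b then 1 else -1)"

text \<open>The total attachment weight of a tree with \<open>n\<close> vertices: the root alone has weight \<open>1\<close>, and each
new vertex adds \<open>\<alpha>\<close> to its parent and brings \<open>\<beta>\<close> itself.\<close>

definition mass :: "real \<Rightarrow> real \<Rightarrow> nat \<Rightarrow> real" where
  "mass \<alpha> \<beta> n = 1 + (\<alpha> + \<beta>) * (real n - 1)"

text \<open>The bit \<open>b\<close> says whether the chosen parent has the root color, and \<open>s\<close> whether the color is kept.\<close>

definition urn_step :: "real \<Rightarrow> real \<Rightarrow> real \<Rightarrow> nat \<Rightarrow> real \<times> real \<Rightarrow> (real \<times> real) pmf" where
  "urn_step \<alpha> \<beta> q n = (\<lambda>(y, w). do {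
     b \<leftarrow> bernoulli_pmf ((1 + w / mass \<alpha> \<beta> n) / 2);
     s \<leftarrow> map_pmf Not (bernoulli_pmf q);
     return_pmf (y + spin s * spin b, w + (\<alpha> + \<beta> * spin s) * spin b) })"

lemma finite_urn_step: "finite (set_pmf (urn_step \<alpha> \<beta> q n x))"
  by (cases x) (auto simp: urn_step_def set_bind_pmf intro!: finite_UN_I)

lemma expectation_urn_step:
  fixes F :: "real \<times> real \<Rightarrow> real"
  assumes "0 \<le> q" "q \<le> 1" "\<bar>w\<bar> \<le> mass \<alpha> \<beta> n" "0 < mass \<alpha> \<beta> n"
  defines "r \<equiv> w / mass \<alpha> \<beta> n"
  shows "measure_pmf.expectation (urn_step \<alpha> \<beta> q n (y, w)) F =
    (1 + r) / 2 * ((1 - q) * F (y + 1, w + (\<alpha> + \<beta>)) + q * F (y - 1, w + (\<alpha> - \<beta>))) +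
    (1 - r) / 2 * ((1 - q) * F (y - 1, w - (\<alpha> + \<beta>)) + q * F (y + 1, w - (\<alpha> - \<beta>)))"
proof -
  have r: "0 \<le> (1 + r) / 2" "(1 + r) / 2 \<le> 1"
    using assms by (auto simp: field_simps abs_le_iff)
  have 1: "measure_pmf.expectation (map_pmf Not (bernoulli_pmf q) \<bind> (\<lambda>s. return_pmf (y + spin s * c, w + (\<alpha> + \<beta> * spin s) * c))) F
     = (1 - q) * F (y + c, w + (\<alpha> + \<beta>) * c) + q * F (y - c, w + (\<alpha> - \<beta>) * c)" for c
    unfolding bind_map_pmf using assms(1,2)
    by (subst pmf_expectation_bind[of UNIV]) (auto simp: UNIV_bool spin_def)
  have "measure_pmf.expectation (urn_step \<alpha> \<beta> q n (y, w)) F =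
     (\<Sum>b\<in>UNIV. pmf (bernoulli_pmf ((1 + r) / 2)) b *\<^sub>R
        measure_pmf.expectation (map_pmf Not (bernoulli_pmf q) \<bind> (\<lambda>s. return_pmf (y + spin s * spin b, w + (\<alpha> + \<beta> * spin s) * spin b))) F)"
    unfolding urn_step_def r_def prod.case
    by (subst pmf_expectation_bind[of UNIV]) (auto simp: set_bind_pmf intro!: finite_UN_I)
  also have "\<dots> = (1 + r) / 2 * ((1 - q) * F (y + 1, w + (\<alpha> + \<beta>)) + q * F (y - 1, w + (\<alpha> - \<beta>))) +
    (1 - r) / 2 * ((1 - q) * F (y - 1, w - (\<alpha> + \<beta>)) + q * F (y + 1, w - (\<alpha> - \<beta>)))"
    unfolding 1 using r by (simp add: UNIV_bool spin_def algebra_simps diff_divide_distrib add_divide_distrib)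
  finally show ?thesis .
qed

text \<open>The hypothesis \<open>weight_bound\<close> makes \<open>(1 + w / mass \<alpha> \<beta> n) / 2\<close> a probability. It has to be required
of the states that occur, since for negative \<open>\<alpha>\<close> a step of the urn need not preserve the bound.\<close>

locale two_color_urn =
  fixes \<alpha> \<beta> q :: real and M :: "nat \<Rightarrow> (real \<times> real) pmf"
  assumes q01: "0 \<le> q" "q \<le> 1"
    and mass_grows: "\<alpha> + \<beta> > 0"
    and drift_lower: "-2 \<le> \<alpha> + \<beta> * (1 - 2 * q)"
    and subcritical: "2 * (\<alpha> + \<beta> * (1 - 2 * q)) \<le> \<alpha> + \<beta>"
    and start: "M 1 = return_pmf (1, 1)"
    and step: "\<And>n. n \<ge> 1 \<Longrightarrow> M (Suc n) = M n \<bind> urn_step \<alpha> \<beta> q n"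
    and weight_bound: "\<And>n y w. n \<ge> 1 \<Longrightarrow> (y, w) \<in> set_pmf (M n) \<Longrightarrow> \<bar>w\<bar> \<le> mass \<alpha> \<beta> n"
begin

definition "\<gamma> = \<alpha> + \<beta>"

lemma gamma_pos: "\<gamma> > 0" using mass_grows by (simp add: \<gamma>_def)

definition "\<mu> = 1 - 2 * q"

definition "\<rho> = \<alpha> + \<beta> * \<mu>"

abbreviation D where "D \<equiv> mass \<alpha> \<beta>"

lemma D_eq: "D n = 1 + \<gamma> * (real n - 1)"
  by (simp add: mass_def \<gamma>_def)

lemma D_ge_1: "n \<ge> 1 \<Longrightarrow> D n \<ge> 1"
  using gamma_pos by (simp add: D_eq)

lemma D_pos: "n \<ge> 1 \<Longrightarrow> D n > 0"
  using D_ge_1[of n] by simp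

lemma D_Suc: "D (Suc n) = D n + \<gamma>"
  by (simp add: D_eq algebra_simps)

lemma mu_bound: "\<bar>\<mu>\<bar> \<le> 1" using q01 by (simp add: \<mu>_def abs_le_iff)

lemma rho_le: "2 * \<rho> \<le> \<gamma>" using subcritical by (simp add: \<rho>_def \<mu>_def \<gamma>_def)

lemma finite_M: "n \<ge> 1 \<Longrightarrow> finite (set_pmf (M n))"
  by (induction n rule: nat_induct_at_least)
     (auto simp: start step set_bind_pmf intro!: finite_urn_step simp del: One_nat_def)

lemma expectation_step:
  fixes F :: "real \<times> real \<Rightarrow> 'b :: {banach, second_countable_topology}"
  assumes "n \<ge> 1"
  shows "measure_pmf.expectation (M (Suc n)) F =
    measure_pmf.expectation (M n) (\<lambda>x. measure_pmf.expectation (urn_step \<alpha> \<beta> q n x) F)"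
  unfolding step[OF assms]
  using finite_M[OF assms] finite_urn_step
  by (subst pmf_expectation_bind[of "set_pmf (M n)"]) (auto simp: integral_measure_pmf[of "set_pmf (M n)"])

section \<open>The forecast martingale\<close>

text \<open>The factor by which \<open>w\<close> grows in the mean between times \<open>k\<close> and \<open>N\<close>.\<close>

definition growth :: "nat \<Rightarrow> nat \<Rightarrow> real" where
  "growth N k = (\<Prod>l\<in>{k..<N}. 1 + \<rho> / D l)"

text \<open>Since \<open>y\<close> changes by \<open>\<mu> * w / D l\<close> in the mean at time \<open>l\<close>, the conditional expectation of the value of
\<open>y\<close> at time \<open>N\<close>, given the state \<open>(y, w)\<close> at time \<open>k\<close>, is \<open>y + fcoeff N k * w\<close>. The factor
\<open>growth N (Suc l)\<close> appears in place of the growth from \<open>k\<close> to \<open>l\<close>: the two sums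
are equal, and the present one is convenient for backward induction.\<close>

definition fcoeff :: "nat \<Rightarrow> nat \<Rightarrow> real" where
  "fcoeff N k = \<mu> * (\<Sum>l\<in>{k..<N}. growth N (Suc l) / D l)"

lemma growth_self: "growth N N = 1" and fcoeff_self: "fcoeff N N = 0"
  by (simp_all add: growth_def fcoeff_def)

lemma growth_rec: "k < N \<Longrightarrow> growth N k = growth N (Suc k) * (1 + \<rho> / D k)"
  by (simp add: growth_def prod.atLeast_Suc_lessThan mult.commute)

lemma fcoeff_rec': "k < N \<Longrightarrow> fcoeff N k = fcoeff N (Suc k) + \<mu> * growth N (Suc k) / D k"
  by (simp add: fcoeff_def sum.atLeast_Suc_lessThan algebra_simps)

text \<open>The vector \<open>(1, fcoeff N k)\<close> is the forecast as a linear form in \<open>(y, w)\<close>, and \<open>(\<mu>, \<rho>)\<close> is the drift of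
\<open>(y, w)\<close> per unit of \<open>w / D k\<close>. Pairing the two gives \<open>\<mu>\<close> times the growth factor. This identity yields
the recursion of \<open>fcoeff\<close>, its bounds, and a lower bound for the variance of the increments.\<close>

lemma drift_fcoeff: "k \<le> N \<Longrightarrow> \<mu> + \<rho> * fcoeff N k = \<mu> * growth N k"
proof (induction k rule: inc_induct)
  case base thus ?case by (simp add: growth_self fcoeff_self)
next
  case (step k)
  thus ?case by (simp add: fcoeff_rec' growth_rec algebra_simps)
qed

lemma fcoeff_rec: "k < N \<Longrightarrow> fcoeff N k = fcoeff N (Suc k) + (\<mu> + \<rho> * fcoeff N (Suc k)) / D k"
  using drift_fcoeff[of "Suc k" N] by (simp add: fcoeff_rec')

text \<open>The second moment of \<open>s + x * (\<alpha> + \<beta> * s)\<close>, where \<open>s\<close> is \<open>-1\<close> with probability \<open>q\<close> and \<open>1\<close> otherwise.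
With \<open>x = fcoeff N (Suc k)\<close> this is what a new vertex adds to the forecast, up to sign and centring.\<close>

definition step_var :: "real \<Rightarrow> real" where
  "step_var x = (1 - q) * (1 + x * (\<alpha> + \<beta>))\<^sup>2 + q * (1 - x * (\<alpha> - \<beta>))\<^sup>2"

lemma step_var_eq: "step_var x = (\<mu> + \<rho> * x)\<^sup>2 + 4 * q * (1 - q) * (1 + \<beta> * x)\<^sup>2"
  unfolding step_var_def \<rho>_def \<mu>_def by algebra

lemma step_var_nonneg: "step_var x \<ge> 0" using q01 by (simp add: step_var_def)

text \<open>A second moment is at least the square of the mean, which is \<open>\<mu> + \<rho> * x\<close>.\<close>

lemma step_var_ge: "(\<mu> + \<rho> * x)\<^sup>2 \<le> step_var x"
  using q01 by (simp add: step_var_eq)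

definition "coeff_const = 1 + \<bar>\<alpha>\<bar> + \<bar>\<beta>\<bar>"

lemma coeff_const_ge_1: "coeff_const \<ge> 1" by (simp add: coeff_const_def)

lemma coeff_bound:
  "\<bar>1 + x * (\<alpha> + \<beta>)\<bar> \<le> coeff_const * (1 + \<bar>x\<bar>)" "\<bar>1 - x * (\<alpha> - \<beta>)\<bar> \<le> coeff_const * (1 + \<bar>x\<bar>)"
proof -
  have "\<bar>x * (\<alpha> + \<beta>)\<bar> \<le> \<bar>x\<bar> * (\<bar>\<alpha>\<bar> + \<bar>\<beta>\<bar>)" "\<bar>x * (\<alpha> - \<beta>)\<bar> \<le> \<bar>x\<bar> * (\<bar>\<alpha>\<bar> + \<bar>\<beta>\<bar>)"
    unfolding abs_mult by (intro mult_left_mono; simp)+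
  moreover have "coeff_const * (1 + \<bar>x\<bar>) = 1 + \<bar>x\<bar> * (\<bar>\<alpha>\<bar> + \<bar>\<beta>\<bar>) + (\<bar>\<alpha>\<bar> + \<bar>\<beta>\<bar> + \<bar>x\<bar>)"
    by (simp add: coeff_const_def algebra_simps)
  ultimately show "\<bar>1 + x * (\<alpha> + \<beta>)\<bar> \<le> coeff_const * (1 + \<bar>x\<bar>)" "\<bar>1 - x * (\<alpha> - \<beta>)\<bar> \<le> coeff_const * (1 + \<bar>x\<bar>)"
    by linarith+
qed

lemma step_var_le: "step_var x \<le> (coeff_const * (1 + \<bar>x\<bar>))\<^sup>2"
proof -
  have "step_var x \<le> (1 - q) * (coeff_const * (1 + \<bar>x\<bar>))\<^sup>2 + q * (coeff_const * (1 + \<bar>x\<bar>))\<^sup>2"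
    unfolding step_var_def using q01 coeff_bound[of x]
    by (intro add_mono mult_left_mono) (auto simp: abs_le_square_iff[symmetric] coeff_const_def)
  thus ?thesis by (simp add: algebra_simps)
qed

lemma step_var_lower:
  assumes "\<bar>x\<bar> * coeff_const \<le> 1/2"
  shows "1/4 \<le> step_var x"
proof -
  have "\<bar>x * (\<alpha> + \<beta>)\<bar> \<le> \<bar>x\<bar> * coeff_const" "\<bar>x * (\<alpha> - \<beta>)\<bar> \<le> \<bar>x\<bar> * coeff_const"
    unfolding abs_mult coeff_const_def by (intro mult_left_mono; simp)+
  hence "1/2 \<le> 1 + x * (\<alpha> + \<beta>)" "1/2 \<le> 1 - x * (\<alpha> - \<beta>)" using assms by linarith+
  hence sq: "(1/2)\<^sup>2 \<le> (1 + x * (\<alpha> + \<beta>))\<^sup>2" "(1/2)\<^sup>2 \<le> (1 - x * (\<alpha> - \<beta>))\<^sup>2"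
    by (intro power_mono; simp)+
  have "(1 - q) * (1/2)\<^sup>2 + q * (1/2)\<^sup>2 \<le> step_var x"
    unfolding step_var_def using q01 sq by (intro add_mono mult_left_mono) auto
  also have "(1 - q) * (1/2)\<^sup>2 + q * (1/2)\<^sup>2 = 1/4"
    by (simp add: power2_eq_square add_divide_distrib[symmetric])
  finally show ?thesis .
qed

definition forecast :: "nat \<Rightarrow> nat \<Rightarrow> real \<times> real \<Rightarrow> real" where
  "forecast N k = (\<lambda>(y, w). y + fcoeff N k * w)"

text \<open>The forecast is a martingale. The conditional second moment of its increment is deterministic except
for the term \<open>(w / D k)\<^sup>2\<close> that comes from the centring.\<close>

lemma increment:
  fixes y w :: real
  assumes k: "1 \<le> k" "k < N" and w: "\<bar>w\<bar> \<le> D k"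
  defines "x \<equiv> fcoeff N (Suc k)"
  defines "X \<equiv> \<lambda>s. forecast N (Suc k) s - forecast N k (y, w)"
  shows "measure_pmf.expectation (urn_step \<alpha> \<beta> q k (y, w)) X = 0"
    and "measure_pmf.expectation (urn_step \<alpha> \<beta> q k (y, w)) (\<lambda>s. (X s)\<^sup>2) = step_var x - (\<mu> + \<rho> * x)\<^sup>2 * (w / D k)\<^sup>2"
    and "s \<in> set_pmf (urn_step \<alpha> \<beta> q k (y, w)) \<Longrightarrow> \<bar>X s\<bar> \<le> 2 * coeff_const * (1 + \<bar>x\<bar>)"
proof -
  define r where "r = w / D k"
  have Dk: "D k > 0" using D_pos k by simp
  have r: "\<bar>r\<bar> \<le> 1" using w Dk by (simp add: r_def)
  define a b where "a = 1 + x * (\<alpha> + \<beta>)" and "b = - 1 + x * (\<alpha> - \<beta>)"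
  have ab: "\<mu> + \<rho> * x = (1 - q) * a + q * b"
    by (simp add: a_def b_def \<rho>_def \<mu>_def algebra_simps)
  have X: "X (y + u, w + v) = u + x * v - (\<mu> + \<rho> * x) * r" for u v
  proof -
    have "fcoeff N k * w = x * w + (\<mu> + \<rho> * x) * r"
      using fcoeff_rec[OF k(2)] by (simp add: x_def r_def algebra_simps add_divide_distrib)
    thus ?thesis by (simp add: X_def forecast_def x_def[symmetric] distrib_left)
  qed
  have X': "X (y + 1, w + (\<alpha> + \<beta>)) = a - (\<mu> + \<rho> * x) * r"
    "X (y - 1, w + (\<alpha> - \<beta>)) = b - (\<mu> + \<rho> * x) * r"
    "X (y - 1, w - (\<alpha> + \<beta>)) = - a - (\<mu> + \<rho> * x) * r"
    "X (y + 1, w - (\<alpha> - \<beta>)) = - b - (\<mu> + \<rho> * x) * r"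
    using X[of 1 "\<alpha> + \<beta>"] X[of "-1" "\<alpha> - \<beta>"] X[of "-1" "- (\<alpha> + \<beta>)"] X[of 1 "- (\<alpha> - \<beta>)"]
    by (simp_all add: a_def b_def algebra_simps)
  note E = expectation_urn_step[OF q01 w Dk, folded r_def]
  show "measure_pmf.expectation (urn_step \<alpha> \<beta> q k (y, w)) X = 0"
    unfolding E X' ab by (simp add: field_simps)
  show "measure_pmf.expectation (urn_step \<alpha> \<beta> q k (y, w)) (\<lambda>s. (X s)\<^sup>2) = step_var x - (\<mu> + \<rho> * x)\<^sup>2 * (w / D k)\<^sup>2"
  proof -
    have "step_var x = (1 - q) * a\<^sup>2 + q * b\<^sup>2" by (simp add: step_var_def a_def b_def power2_commute[of _ 1])
    thus ?thesis unfolding E X' ab r_def[symmetric] by (simp add: field_simps power2_eq_square)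
  qed
  show "\<bar>X s\<bar> \<le> 2 * coeff_const * (1 + \<bar>x\<bar>)" if "s \<in> set_pmf (urn_step \<alpha> \<beta> q k (y, w))"
  proof -
    from that obtain b1 b2 where s: "s = (y + spin b1 * spin b2, w + (\<alpha> + \<beta> * spin b1) * spin b2)"
      by (auto simp: urn_step_def set_bind_pmf)
    have "\<bar>spin b1 * spin b2 + x * ((\<alpha> + \<beta> * spin b1) * spin b2)\<bar> \<le> coeff_const * (1 + \<bar>x\<bar>)"
      using coeff_bound[of x] by (cases b1; cases b2) (auto simp: spin_def algebra_simps abs_le_iff)
    moreover have "\<bar>(\<mu> + \<rho> * x) * r\<bar> \<le> coeff_const * (1 + \<bar>x\<bar>)"
    proof -
      have "\<mu> + \<rho> * x = (1 - q) * (1 + x * (\<alpha> + \<beta>)) + q * (- (1 - x * (\<alpha> - \<beta>)))"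
        unfolding \<rho>_def \<mu>_def by algebra
      hence "\<bar>\<mu> + \<rho> * x\<bar> \<le> (1 - q) * \<bar>1 + x * (\<alpha> + \<beta>)\<bar> + q * \<bar>1 - x * (\<alpha> - \<beta>)\<bar>"
        using abs_triangle_ineq[of "(1 - q) * (1 + x * (\<alpha> + \<beta>))" "q * (- (1 - x * (\<alpha> - \<beta>)))"] q01
        by (simp add: abs_mult abs_minus_commute[of 1])
      also have "\<dots> \<le> (1 - q) * (coeff_const * (1 + \<bar>x\<bar>)) + q * (coeff_const * (1 + \<bar>x\<bar>))"
        using q01 coeff_bound[of x] by (intro add_mono mult_left_mono) auto
      also have "\<dots> = coeff_const * (1 + \<bar>x\<bar>)" by algebra
      finally have "\<bar>\<mu> + \<rho> * x\<bar> \<le> coeff_const * (1 + \<bar>x\<bar>)" .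
      thus ?thesis using r mult_mono[of "\<bar>\<mu> + \<rho> * x\<bar>" "coeff_const * (1 + \<bar>x\<bar>)" "\<bar>r\<bar>" 1]
        by (simp add: abs_mult coeff_const_def)
    qed
    ultimately show ?thesis unfolding s X by linarith
  qed
qed

section \<open>Comparison of characteristic functions\<close>

definition rel_moment :: "nat \<Rightarrow> real" where
  "rel_moment k = measure_pmf.expectation (M k) (\<lambda>s. (snd s / D k)\<^sup>2)"

definition \<phi> :: "real \<Rightarrow> nat \<Rightarrow> nat \<Rightarrow> complex" where
  "\<phi> \<tau> N k = measure_pmf.expectation (M k) (\<lambda>s. iexp (\<tau> * forecast N k s))"

text \<open>One increment multiplies the characteristic function by almost a Gaussian factor: condition on the
state at time \<open>k\<close> and apply \<open>pmf_char_approx\<close> to the increment of the forecast.\<close>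

lemma char_step:
  assumes k: "1 \<le> k" "k < N"
  defines "x \<equiv> fcoeff N (Suc k)"
  shows "cmod (\<phi> \<tau> N (Suc k) - exp (- (\<tau>\<^sup>2 * step_var x / 2)) * \<phi> \<tau> N k)
    \<le> \<bar>\<tau>\<bar> ^ 3 * step_var x * (coeff_const * (1 + \<bar>x\<bar>)) / 3 + \<tau>\<^sup>2 * (step_var x * rel_moment k) / 2 + \<tau> ^ 4 * (step_var x)\<^sup>2 / 8"
proof -
  note int = integrable_measure_pmf_finite[OF finite_M[OF k(1)]]
  define E where "E = complex_of_real (exp (- (\<tau>\<^sup>2 * step_var x / 2)))"
  define K where "K = urn_step \<alpha> \<beta> q k"
  define X where "X = (\<lambda>s s'. forecast N (Suc k) s' - forecast N k s)"
  define J where "J = (\<lambda>s. measure_pmf.expectation (K s) (\<lambda>s'. iexp (\<tau> * X s s')))"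
  have "\<phi> \<tau> N (Suc k) = measure_pmf.expectation (M k) (\<lambda>s. measure_pmf.expectation (K s) (\<lambda>s'. iexp (\<tau> * forecast N (Suc k) s')))"
    unfolding \<phi>_def K_def by (rule expectation_step[OF k(1)])
  also have "\<dots> = measure_pmf.expectation (M k) (\<lambda>s. iexp (\<tau> * forecast N k s) * J s)"
  proof (rule Bochner_Integration.integral_cong[OF refl])
    fix s
    have "iexp (\<tau> * forecast N (Suc k) s') = iexp (\<tau> * forecast N k s) * iexp (\<tau> * X s s')" for s'
      by (simp add: X_def exp_add[symmetric] algebra_simps)
    thus "measure_pmf.expectation (K s) (\<lambda>s'. iexp (\<tau> * forecast N (Suc k) s')) = iexp (\<tau> * forecast N k s) * J s"
      by (simp add: J_def)
  qed
  finally have "\<phi> \<tau> N (Suc k) - E * \<phi> \<tau> N k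
      = measure_pmf.expectation (M k) (\<lambda>s. iexp (\<tau> * forecast N k s) * J s - iexp (\<tau> * forecast N k s) * E)"
    unfolding \<phi>_def by (subst Bochner_Integration.integral_diff[OF int int]) simp
  hence "cmod (\<phi> \<tau> N (Suc k) - E * \<phi> \<tau> N k)
      = cmod (measure_pmf.expectation (M k) (\<lambda>s. iexp (\<tau> * forecast N k s) * J s - iexp (\<tau> * forecast N k s) * E))"
    by (rule arg_cong)
  also have "\<dots> \<le> measure_pmf.expectation (M k) (\<lambda>s. cmod (iexp (\<tau> * forecast N k s) * J s - iexp (\<tau> * forecast N k s) * E))"
    by (rule integral_norm_bound)
  also have "\<dots> \<le> measure_pmf.expectation (M k) (\<lambda>s. (\<bar>\<tau>\<bar> ^ 3 * step_var x * (coeff_const * (1 + \<bar>x\<bar>)) / 3 + \<tau> ^ 4 * (step_var x)\<^sup>2 / 8)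
      + \<tau>\<^sup>2 * step_var x / 2 * (snd s / D k)\<^sup>2)"
  proof (rule integral_mono_AE[OF int int], unfold AE_measure_pmf_iff, rule ballI)
    fix s assume s: "s \<in> set_pmf (M k)"
    obtain y w where yw: "s = (y, w)" by (cases s)
    have w: "\<bar>w\<bar> \<le> D k" using weight_bound k(1) s yw by blast
    define v where "v = step_var x - (\<mu> + \<rho> * x)\<^sup>2 * (w / D k)\<^sup>2"
    note inc = increment[OF k w, folded x_def, where y = y, folded yw K_def, folded v_def]
    \<comment> \<open>The random part of the conditional variance is at most \<open>(w / D k)\<^sup>2\<close> times the deterministic one.\<close>
    have sq: "(\<mu> + \<rho> * x)\<^sup>2 * (w / D k)\<^sup>2 \<le> step_var x * (w / D k)\<^sup>2"
      using step_var_ge by (intro mult_right_mono) auto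
    have "cmod (iexp (\<tau> * forecast N k s) * J s - iexp (\<tau> * forecast N k s) * E) = cmod (J s - E)"
      unfolding right_diff_distrib[symmetric] norm_mult by (simp del: of_real_mult)
    also have "\<dots> \<le> \<bar>\<tau>\<bar> ^ 3 * (2 * coeff_const * (1 + \<bar>x\<bar>)) * v / 6 + \<tau>\<^sup>2 * \<bar>step_var x - v\<bar> / 2 + \<tau> ^ 4 * (step_var x)\<^sup>2 / 8"
      unfolding J_def E_def X_def
      using inc by (intro pmf_char_approx) (auto simp: K_def finite_urn_step step_var_nonneg)
    finally have 1: "cmod (iexp (\<tau> * forecast N k s) * J s - iexp (\<tau> * forecast N k s) * E)
      \<le> \<bar>\<tau>\<bar> ^ 3 * (2 * coeff_const * (1 + \<bar>x\<bar>)) * v / 6 + \<tau>\<^sup>2 * \<bar>step_var x - v\<bar> / 2 + \<tau> ^ 4 * (step_var x)\<^sup>2 / 8" .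
    have "\<bar>step_var x - v\<bar> \<le> step_var x * (snd s / D k)\<^sup>2"
      using sq by (simp add: v_def abs_mult yw)
    hence "\<tau>\<^sup>2 * \<bar>step_var x - v\<bar> \<le> \<tau>\<^sup>2 * (step_var x * (snd s / D k)\<^sup>2)" by (rule mult_left_mono) simp
    moreover have "\<bar>\<tau>\<bar> ^ 3 * (2 * coeff_const * (1 + \<bar>x\<bar>)) * v \<le> \<bar>\<tau>\<bar> ^ 3 * (2 * coeff_const * (1 + \<bar>x\<bar>)) * step_var x"
      using coeff_const_ge_1 by (intro mult_left_mono) (auto simp: v_def)
    moreover have "\<bar>\<tau>\<bar> ^ 3 * (2 * coeff_const * (1 + \<bar>x\<bar>)) * step_var x = 2 * (\<bar>\<tau>\<bar> ^ 3 * step_var x * (coeff_const * (1 + \<bar>x\<bar>)))"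
      by (simp only: mult_ac)
    moreover have "\<tau>\<^sup>2 * step_var x / 2 * (snd s / D k)\<^sup>2 = \<tau>\<^sup>2 * (step_var x * (snd s / D k)\<^sup>2) / 2" by simp
    ultimately show "cmod (iexp (\<tau> * forecast N k s) * J s - iexp (\<tau> * forecast N k s) * E)
       \<le> (\<bar>\<tau>\<bar> ^ 3 * step_var x * (coeff_const * (1 + \<bar>x\<bar>)) / 3 + \<tau> ^ 4 * (step_var x)\<^sup>2 / 8) + \<tau>\<^sup>2 * step_var x / 2 * (snd s / D k)\<^sup>2"
      using 1 by linarith
  qed
  also have "\<dots> = (\<bar>\<tau>\<bar> ^ 3 * step_var x * (coeff_const * (1 + \<bar>x\<bar>)) / 3 + \<tau> ^ 4 * (step_var x)\<^sup>2 / 8) + \<tau>\<^sup>2 * step_var x / 2 * rel_moment k"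
    unfolding rel_moment_def by (subst Bochner_Integration.integral_add[OF int int]) simp
  finally show ?thesis by (simp add: E_def)
qed

text \<open>Gaussian factors are at most \<open>1\<close>, so the errors of the single steps just add up.\<close>

lemma char_telescope:
  assumes "1 \<le> k" "k \<le> N"
  shows "cmod (\<phi> \<tau> N k - exp (- (\<tau>\<^sup>2 * (\<Sum>j\<in>{1..<k}. step_var (fcoeff N (Suc j))) / 2)) * \<phi> \<tau> N 1)
    \<le> (\<Sum>j\<in>{1..<k}. \<bar>\<tau>\<bar> ^ 3 * step_var (fcoeff N (Suc j)) * (coeff_const * (1 + \<bar>fcoeff N (Suc j)\<bar>)) / 3
         + \<tau>\<^sup>2 * (step_var (fcoeff N (Suc j)) * rel_moment j) / 2 + \<tau> ^ 4 * (step_var (fcoeff N (Suc j)))\<^sup>2 / 8)"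
    (is "cmod (\<phi> \<tau> N k - ?e k * _) \<le> (\<Sum>j\<in>_. ?b j)")
  using assms
proof (induction k rule: nat_induct_at_least)
  case base thus ?case by simp
next
  case (Suc k)
  let ?E = "exp (- (\<tau>\<^sup>2 * step_var (fcoeff N (Suc k)) / 2))"
  have e: "?e (Suc k) = ?E * ?e k"
  proof -
    have "- (\<tau>\<^sup>2 * (\<Sum>j\<in>{1..<Suc k}. step_var (fcoeff N (Suc j))) / 2)
        = - (\<tau>\<^sup>2 * step_var (fcoeff N (Suc k)) / 2) + - (\<tau>\<^sup>2 * (\<Sum>j\<in>{1..<k}. step_var (fcoeff N (Suc j))) / 2)"
      using Suc.hyps by (simp add: distrib_left add_divide_distrib)
    thus ?thesis by (simp only: exp_add of_real_mult)
  qed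
  have "?E \<le> 1" using step_var_nonneg by simp
  have "\<phi> \<tau> N (Suc k) - ?e (Suc k) * \<phi> \<tau> N 1
     = (\<phi> \<tau> N (Suc k) - ?E * \<phi> \<tau> N k) + ?E * (\<phi> \<tau> N k - ?e k * \<phi> \<tau> N 1)"
    unfolding e by (simp add: algebra_simps)
  hence "cmod (\<phi> \<tau> N (Suc k) - ?e (Suc k) * \<phi> \<tau> N 1)
     = cmod ((\<phi> \<tau> N (Suc k) - ?E * \<phi> \<tau> N k) + ?E * (\<phi> \<tau> N k - ?e k * \<phi> \<tau> N 1))"
    by (rule arg_cong)
  also have "\<dots> \<le> cmod (\<phi> \<tau> N (Suc k) - ?E * \<phi> \<tau> N k) + ?E * cmod (\<phi> \<tau> N k - ?e k * \<phi> \<tau> N 1)"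
    by (rule order_trans[OF norm_triangle_ineq]) (simp only: norm_mult norm_of_real abs_exp_cancel order_refl)
  also have "\<dots> \<le> ?b k + 1 * (\<Sum>j\<in>{1..<k}. ?b j)"
  proof (rule add_mono)
    show "cmod (\<phi> \<tau> N (Suc k) - ?E * \<phi> \<tau> N k) \<le> ?b k"
      using Suc.hyps Suc.prems by (intro char_step) simp_all
    have "cmod (\<phi> \<tau> N k - ?e k * \<phi> \<tau> N 1) \<le> (\<Sum>j\<in>{1..<k}. ?b j)"
      by (rule Suc.IH) (use Suc.prems in simp)
    with \<open>?E \<le> 1\<close> show "?E * cmod (\<phi> \<tau> N k - ?e k * \<phi> \<tau> N 1) \<le> 1 * (\<Sum>j\<in>{1..<k}. ?b j)"
      by (rule mult_mono) simp_all
  qed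
  finally show ?case using Suc.hyps by (simp add: add.commute)
qed

definition total_var :: "nat \<Rightarrow> real" where
  "total_var N = (\<Sum>j\<in>{1..<N}. step_var (fcoeff N (Suc j)))"

lemma total_var_nonneg: "total_var N \<ge> 0"
  by (simp add: total_var_def step_var_nonneg sum_nonneg)

text \<open>At time \<open>N\<close> the forecast is \<open>y\<close>, at time \<open>1\<close> it is the constant \<open>1 + fcoeff N 1\<close>. After dividing by
the standard deviation \<open>sqrt (total_var N)\<close>, all error terms are controlled by the ratio
\<open>(1 + G)\<^sup>2 / total_var N\<close> and by an average of the moments \<open>rel_moment j\<close>.\<close>

lemma char_final_bound:
  fixes t G :: real
  assumes N: "1 \<le> N" and R: "total_var N > 0" and G: "\<And>k. k \<in> {1..N} \<Longrightarrow> \<bar>fcoeff N k\<bar> \<le> G"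
  defines "\<tau> \<equiv> t / sqrt (total_var N)"
  shows "cmod (measure_pmf.expectation (M N) (\<lambda>s. iexp (\<tau> * fst s)) - exp (- t\<^sup>2 / 2) * iexp (\<tau> * (1 + fcoeff N 1)))
    \<le> \<bar>t\<bar> ^ 3 * coeff_const / 3 * sqrt ((1 + G)\<^sup>2 / total_var N) + t\<^sup>2 / 2 * ((\<Sum>j\<in>{1..<N}. step_var (fcoeff N (Suc j)) * rel_moment j) / total_var N)
       + t ^ 4 * coeff_const\<^sup>2 / 8 * ((1 + G)\<^sup>2 / total_var N)"
proof -
  have G0: "G \<ge> 0" using G[of N] N by simp
  have \<tau>2: "\<tau>\<^sup>2 * total_var N = t\<^sup>2" "\<tau>\<^sup>2 = t\<^sup>2 / total_var N" using R by (simp_all add: \<tau>_def power_divide)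
  have \<tau>4: "\<tau> ^ 4 * total_var N = t ^ 4 / total_var N"
  proof -
    have "\<tau> ^ 4 * total_var N = \<tau>\<^sup>2 * (\<tau>\<^sup>2 * total_var N)" by (simp add: power2_eq_square power4_eq_xxxx)
    also have "\<dots> = t\<^sup>2 / total_var N * t\<^sup>2" unfolding \<tau>2(1) by (simp only: \<tau>2(2))
    finally show ?thesis by (simp add: power2_eq_square power4_eq_xxxx)
  qed
  have \<tau>3: "\<bar>\<tau>\<bar> ^ 3 * total_var N = \<bar>t\<bar> ^ 3 / sqrt (total_var N)"
  proof -
    have cube: "\<bar>x\<bar> ^ 3 = \<bar>x\<bar> * x\<^sup>2" for x :: real
      using power_Suc[of "\<bar>x\<bar>" 2] by simp
    have "\<bar>\<tau>\<bar> ^ 3 * total_var N = \<bar>\<tau>\<bar> * t\<^sup>2"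
      unfolding cube \<tau>2(1)[symmetric] by (rule mult.assoc)
    moreover have "\<bar>\<tau>\<bar> = \<bar>t\<bar> / sqrt (total_var N)" using R by (simp add: \<tau>_def)
    ultimately show ?thesis unfolding cube[of t] by simp
  qed
  have end_: "\<phi> \<tau> N N = measure_pmf.expectation (M N) (\<lambda>s. iexp (\<tau> * fst s))"
    by (simp add: \<phi>_def forecast_def fcoeff_self case_prod_beta)
  have start_: "\<phi> \<tau> N 1 = iexp (\<tau> * (1 + fcoeff N 1))"
    by (simp add: \<phi>_def forecast_def start del: One_nat_def)
  have "cmod (\<phi> \<tau> N N - exp (- (\<tau>\<^sup>2 * total_var N / 2)) * \<phi> \<tau> N 1)
    \<le> (\<Sum>j\<in>{1..<N}. \<bar>\<tau>\<bar> ^ 3 * step_var (fcoeff N (Suc j)) * (coeff_const * (1 + \<bar>fcoeff N (Suc j)\<bar>)) / 3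
         + \<tau>\<^sup>2 * (step_var (fcoeff N (Suc j)) * rel_moment j) / 2 + \<tau> ^ 4 * (step_var (fcoeff N (Suc j)))\<^sup>2 / 8)"
    using char_telescope[of N N \<tau>] N by (simp add: total_var_def)
  also have "\<dots> \<le> (\<Sum>j\<in>{1..<N}. \<bar>\<tau>\<bar> ^ 3 * step_var (fcoeff N (Suc j)) * (coeff_const * (1 + G)) / 3
         + \<tau>\<^sup>2 * (step_var (fcoeff N (Suc j)) * rel_moment j) / 2 + \<tau> ^ 4 * step_var (fcoeff N (Suc j)) * (coeff_const * (1 + G))\<^sup>2 / 8)"
  proof (intro sum_mono add_mono)
    fix j assume j: "j \<in> {1..<N}"
    let ?x = "fcoeff N (Suc j)"
    have x: "coeff_const * (1 + \<bar>?x\<bar>) \<le> coeff_const * (1 + G)" using G[of "Suc j"] j coeff_const_ge_1 by simp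
    show "\<bar>\<tau>\<bar> ^ 3 * step_var ?x * (coeff_const * (1 + \<bar>?x\<bar>)) / 3 \<le> \<bar>\<tau>\<bar> ^ 3 * step_var ?x * (coeff_const * (1 + G)) / 3"
      by (intro divide_right_mono mult_left_mono[OF x]) (auto simp: step_var_nonneg)
    have "0 \<le> coeff_const * (1 + \<bar>?x\<bar>)" using coeff_const_ge_1 by simp
    hence "step_var ?x \<le> (coeff_const * (1 + G))\<^sup>2"
      using step_var_le[of ?x] power_mono[OF x, of 2] by linarith
    hence "\<tau> ^ 4 * step_var ?x * step_var ?x \<le> \<tau> ^ 4 * step_var ?x * (coeff_const * (1 + G))\<^sup>2"
      by (rule mult_left_mono) (simp add: step_var_nonneg)
    thus "\<tau> ^ 4 * (step_var ?x)\<^sup>2 / 8 \<le> \<tau> ^ 4 * step_var ?x * (coeff_const * (1 + G))\<^sup>2 / 8"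
      by (simp add: power2_eq_square[of "step_var ?x"])
  qed simp
  also have "\<dots> = coeff_const * (1 + G) / 3 * (\<bar>\<tau>\<bar> ^ 3 * total_var N) + \<tau>\<^sup>2 / 2 * (\<Sum>j\<in>{1..<N}. step_var (fcoeff N (Suc j)) * rel_moment j)
      + (coeff_const * (1 + G))\<^sup>2 / 8 * (\<tau> ^ 4 * total_var N)"
    unfolding total_var_def sum.distrib sum_distrib_left sum_divide_distrib
    by (intro arg_cong2[of _ _ _ _ "(+)"] sum.cong refl) simp_all
  also have "\<dots> = \<bar>t\<bar> ^ 3 * coeff_const / 3 * sqrt ((1 + G)\<^sup>2 / total_var N) + t\<^sup>2 / 2 * ((\<Sum>j\<in>{1..<N}. step_var (fcoeff N (Suc j)) * rel_moment j) / total_var N)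
       + t ^ 4 * coeff_const\<^sup>2 / 8 * ((1 + G)\<^sup>2 / total_var N)"
  proof -
    have "sqrt ((1 + G)\<^sup>2 / total_var N) = (1 + G) / sqrt (total_var N)" using G0 by (simp add: real_sqrt_divide)
    thus ?thesis unfolding \<tau>3 \<tau>4 \<tau>2(2)
      by (intro arg_cong2[of _ _ _ _ "(+)"]) (simp_all add: power_mult_distrib)
  qed
  finally show ?thesis unfolding end_ start_ \<tau>2(1) by simp
qed

section \<open>Central limit theorem\<close>

definition "\<delta> = min 1 \<gamma>"

lemma delta_pos: "\<delta> > 0" using gamma_pos by (simp add: \<delta>_def)

lemma D_ge_delta: "l \<ge> 1 \<Longrightarrow> D l \<ge> \<delta> * real l"
proof -
  assume "l \<ge> 1"
  hence "\<delta> * (real l - 1) \<le> \<gamma> * (real l - 1)" by (intro mult_right_mono) (auto simp: \<delta>_def)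
  moreover have "\<delta> \<le> 1" by (simp add: \<delta>_def)
  ultimately show ?thesis by (simp add: D_eq algebra_simps)
qed

lemma sum_inverse_D:
  assumes "n \<ge> 1"
  shows "(\<Sum>l\<in>{1..<n}. 1 / D l) \<le> (1 + ln n) / \<delta>"
proof -
  have "(\<Sum>l\<in>{1..<n}. 1 / D l) \<le> (\<Sum>l\<in>{1..<n}. inverse (real l) / \<delta>)"
  proof (rule sum_mono)
    fix l assume l: "l \<in> {1..<n}"
    have "1 / D l \<le> 1 / (\<delta> * real l)"
      using l delta_pos D_ge_delta[of l] by (intro divide_left_mono) (auto intro!: mult_pos_pos D_pos)
    thus "1 / D l \<le> inverse (real l) / \<delta>" by (simp add: field_simps)
  qed
  also have "\<dots> = (\<Sum>l\<in>{1..<n}. inverse (real l)) / \<delta>" by (simp add: sum_divide_distrib)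
  also have "\<dots> \<le> harm n / \<delta>"
    unfolding harm_def using delta_pos by (intro divide_right_mono sum_mono2) auto
  also have "\<dots> \<le> (1 + ln n) / \<delta>"
    using euler_mascheroni_sequence_decreasing[of 1 n] assms delta_pos
    by (intro divide_right_mono) (auto simp: harm_def)
  finally show ?thesis .
qed

text \<open>The second moment of \<open>w\<close> is multiplied by \<open>1 + 2 * \<rho> / D k\<close> in each step and gains a bounded amount.
Because \<open>2 * \<rho> \<le> \<gamma>\<close>, the factor is at most \<open>D (Suc k) / D k\<close>, so the quotient of the second moment
by \<open>D k\<close> increases at most like a harmonic sum.\<close>

lemma second_moment_le:
  assumes "k \<ge> 1"
  shows "measure_pmf.expectation (M k) (\<lambda>s. (snd s)\<^sup>2) \<le> D k * (1 + coeff_const\<^sup>2 * (\<Sum>l\<in>{2..k}. 1 / D l))"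
  using assms
proof (induction k rule: nat_induct_at_least)
  case base
  show ?case by (simp add: start D_eq del: One_nat_def)
next
  case (Suc k)
  define \<kappa> where "\<kappa> = (1 - q) * (\<alpha> + \<beta>)\<^sup>2 + q * (\<alpha> - \<beta>)\<^sup>2"
  note int = integrable_measure_pmf_finite[OF finite_M[OF Suc.hyps]]
  define e where "e = measure_pmf.expectation (M k) (\<lambda>s. (snd s)\<^sup>2)"
  have "e \<ge> 0" by (simp add: e_def)
  have Dk: "D k > 0" "D (Suc k) > 0" using D_pos Suc.hyps by simp_all
  have "\<kappa> \<le> (1 - q) * coeff_const\<^sup>2 + q * coeff_const\<^sup>2"
    unfolding \<kappa>_def using q01
    by (intro add_mono mult_left_mono) (auto simp: coeff_const_def simp flip: abs_le_square_iff)
  hence \<kappa>: "\<kappa> \<le> coeff_const\<^sup>2" by (simp add: algebra_simps)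
  have "measure_pmf.expectation (M (Suc k)) (\<lambda>s. (snd s)\<^sup>2)
      = measure_pmf.expectation (M k) (\<lambda>s. measure_pmf.expectation (urn_step \<alpha> \<beta> q k s) (\<lambda>s. (snd s)\<^sup>2))"
    by (rule expectation_step[OF Suc.hyps])
  also have "\<dots> = measure_pmf.expectation (M k) (\<lambda>s. (1 + 2 * \<rho> / D k) * (snd s)\<^sup>2 + \<kappa>)"
  proof (rule integral_cong_AE, simp, simp, unfold AE_measure_pmf_iff, rule ballI)
    fix s assume s: "s \<in> set_pmf (M k)"
    obtain y w where yw: "s = (y, w)" by (cases s)
    have w: "\<bar>w\<bar> \<le> D k" using weight_bound Suc.hyps s yw by blast
    define r where "r = w / D k"
    have "(1 + 2 * \<rho> / D k) * w\<^sup>2 = w\<^sup>2 + 2 * \<rho> * r * w"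
      by (simp add: r_def distrib_right power2_eq_square)
    moreover have "measure_pmf.expectation (urn_step \<alpha> \<beta> q k (y, w)) (\<lambda>s. (snd s)\<^sup>2) = w\<^sup>2 + 2 * \<rho> * r * w + \<kappa>"
      unfolding expectation_urn_step[OF q01 w Dk(1), folded r_def] snd_conv
      by (simp add: \<kappa>_def \<rho>_def \<mu>_def field_simps power2_eq_square)
    ultimately show "measure_pmf.expectation (urn_step \<alpha> \<beta> q k s) (\<lambda>s. (snd s)\<^sup>2) = (1 + 2 * \<rho> / D k) * (snd s)\<^sup>2 + \<kappa>"
      by (simp only: yw snd_conv)
  qed
  also have "\<dots> = (1 + 2 * \<rho> / D k) * e + \<kappa>"
    unfolding e_def by (subst Bochner_Integration.integral_add[OF int int]) simp
  also have "\<dots> \<le> (1 + \<gamma> / D k) * e + coeff_const\<^sup>2"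
    using rho_le Dk \<open>e \<ge> 0\<close> \<kappa> by (intro add_mono mult_right_mono) (auto intro: divide_right_mono)
  also have "\<dots> = D (Suc k) * (e / D k) + coeff_const\<^sup>2"
    using Dk by (simp add: D_Suc field_simps)
  also have "\<dots> \<le> D (Suc k) * (1 + coeff_const\<^sup>2 * (\<Sum>l\<in>{2..k}. 1 / D l)) + D (Suc k) * (coeff_const\<^sup>2 * (1 / D (Suc k)))"
    using Suc.IH Dk unfolding e_def[symmetric]
    by (intro add_mono mult_left_mono) (auto simp: pos_divide_le_eq mult.commute)
  also have "\<dots> = D (Suc k) * (1 + coeff_const\<^sup>2 * (\<Sum>l\<in>{2..Suc k}. 1 / D l))"
    using Suc.hyps by (simp only: sum.cl_ivl_Suc) (simp add: algebra_simps)
  finally show ?case .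
qed

lemma rel_moment_tendsto_0: "rel_moment \<longlonglongrightarrow> 0"
proof (rule tendsto_sandwich[of "\<lambda>_. 0" _ _ "\<lambda>k. (1 + coeff_const\<^sup>2 * ((1 + ln (real (Suc k))) / \<delta>)) / (\<delta> * real k)"])
  show "eventually (\<lambda>k. rel_moment k \<le> (1 + coeff_const\<^sup>2 * ((1 + ln (real (Suc k))) / \<delta>)) / (\<delta> * real k)) sequentially"
    using eventually_ge_at_top[of 1]
  proof eventually_elim
    case (elim k)
    have Dk: "D k > 0" using elim by (rule D_pos)
    have "rel_moment k = measure_pmf.expectation (M k) (\<lambda>s. (snd s)\<^sup>2) / (D k)\<^sup>2"
      by (simp add: rel_moment_def power_divide)
    also have "\<dots> \<le> D k * (1 + coeff_const\<^sup>2 * (\<Sum>l\<in>{2..k}. 1 / D l)) / (D k)\<^sup>2"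
      using second_moment_le[OF elim] by (rule divide_right_mono) simp
    also have "\<dots> = (1 + coeff_const\<^sup>2 * (\<Sum>l\<in>{2..k}. 1 / D l)) / D k"
      using Dk by (simp add: power2_eq_square)
    also have "\<dots> \<le> (1 + coeff_const\<^sup>2 * ((1 + ln (real (Suc k))) / \<delta>)) / (\<delta> * real k)"
    proof (rule frac_le)
      have "(\<Sum>l\<in>{2..k}. 1 / D l) \<le> (\<Sum>l\<in>{1..<Suc k}. 1 / D l)"
        by (intro sum_mono2) (auto simp: less_imp_le[OF D_pos])
      also have "\<dots> \<le> (1 + ln (real (Suc k))) / \<delta>" by (rule sum_inverse_D) simp
      finally show "1 + coeff_const\<^sup>2 * (\<Sum>l\<in>{2..k}. 1 / D l) \<le> 1 + coeff_const\<^sup>2 * ((1 + ln (real (Suc k))) / \<delta>)"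
        by (intro add_left_mono mult_left_mono) auto
      show "0 \<le> 1 + coeff_const\<^sup>2 * ((1 + ln (real (Suc k))) / \<delta>)" using delta_pos by simp
      show "0 < \<delta> * real k" using delta_pos elim by simp
      show "\<delta> * real k \<le> D k" using D_ge_delta elim by simp
    qed
    finally show ?case .
  qed
  show "(\<lambda>k. (1 + coeff_const\<^sup>2 * ((1 + ln (real (Suc k))) / \<delta>)) / (\<delta> * real k)) \<longlonglongrightarrow> 0"
    using delta_pos by real_asymp
qed (auto simp: rel_moment_def)

text \<open>The central limit theorem for the urn, under the hypothesis that the coefficients of the forecasts
are negligible compared with the standard deviation.\<close>

lemma char_tendsto:
  fixes t :: real and G :: "nat \<Rightarrow> real"
  assumes G: "\<And>N k. k \<in> {1..N} \<Longrightarrow> \<bar>fcoeff N k\<bar> \<le> G N"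
    and pos: "eventually (\<lambda>N. total_var N > 0) sequentially"
    and negl: "(\<lambda>N. (1 + G N)\<^sup>2 / total_var N) \<longlonglongrightarrow> 0"
  shows "(\<lambda>N. measure_pmf.expectation (M N) (\<lambda>s. iexp (t * (fst s / sqrt (total_var N))))) \<longlonglongrightarrow> exp (- t\<^sup>2 / 2)"
proof -
  define \<theta> where "\<theta> = (\<lambda>N. t / sqrt (total_var N) * (1 + fcoeff N 1))"
  have avg: "(\<lambda>N. (\<Sum>j\<in>{1..<N}. step_var (fcoeff N (Suc j)) * rel_moment j) / total_var N) \<longlonglongrightarrow> 0"
    unfolding total_var_def
  proof (rule weighted_average_tendsto_0[OF _ rel_moment_tendsto_0])
    show "0 \<le> step_var (fcoeff N (Suc j))" for N j by (rule step_var_nonneg)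
    show "eventually (\<lambda>N. 0 < (\<Sum>j\<in>{1..<N}. step_var (fcoeff N (Suc j)))) sequentially"
      using pos by (simp add: total_var_def)
    show "step_var (fcoeff N (Suc j)) \<le> coeff_const\<^sup>2 * (1 + G N)\<^sup>2" if "j \<in> {1..<N}" for N j
    proof -
      have "coeff_const * (1 + \<bar>fcoeff N (Suc j)\<bar>) \<le> coeff_const * (1 + G N)" using G[of "Suc j" N] that coeff_const_ge_1 by simp
      moreover have "0 \<le> coeff_const * (1 + \<bar>fcoeff N (Suc j)\<bar>)" using coeff_const_ge_1 by simp
      ultimately have "(coeff_const * (1 + \<bar>fcoeff N (Suc j)\<bar>))\<^sup>2 \<le> (coeff_const * (1 + G N))\<^sup>2" by (rule power_mono)
      thus ?thesis using step_var_le[of "fcoeff N (Suc j)"] by (simp add: power_mult_distrib)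
    qed
    have "(\<lambda>N. coeff_const\<^sup>2 * ((1 + G N)\<^sup>2 / total_var N)) \<longlonglongrightarrow> coeff_const\<^sup>2 * 0" by (intro tendsto_intros negl)
    thus "(\<lambda>N. coeff_const\<^sup>2 * (1 + G N)\<^sup>2 / (\<Sum>j\<in>{1..<N}. step_var (fcoeff N (Suc j)))) \<longlonglongrightarrow> 0"
      by (simp add: total_var_def)
  qed
  have sq: "(\<lambda>N. sqrt ((1 + G N)\<^sup>2 / total_var N)) \<longlonglongrightarrow> sqrt 0"
    by (intro tendsto_intros negl)
  have "\<theta> \<longlonglongrightarrow> 0"
  proof (rule Lim_null_comparison)
    show "(\<lambda>N. \<bar>t\<bar> * sqrt ((1 + G N)\<^sup>2 / total_var N)) \<longlonglongrightarrow> 0"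
      using tendsto_mult[OF tendsto_const sq, of "\<bar>t\<bar>"] by simp
    show "eventually (\<lambda>N. norm (\<theta> N) \<le> \<bar>t\<bar> * sqrt ((1 + G N)\<^sup>2 / total_var N)) sequentially"
      using eventually_ge_at_top[of 1]
    proof eventually_elim
      case (elim N)
      have "\<bar>1 + fcoeff N 1\<bar> \<le> 1 + G N" using G[of 1 N] elim by simp
      hence "\<bar>t\<bar> / sqrt (total_var N) * \<bar>1 + fcoeff N 1\<bar> \<le> \<bar>t\<bar> / sqrt (total_var N) * (1 + G N)"
        by (rule mult_left_mono) (simp add: total_var_nonneg)
      moreover have "0 \<le> G N" using G[of 1 N] elim by simp
      ultimately show ?case by (simp add: \<theta>_def abs_mult total_var_nonneg real_sqrt_divide)
    qed
  qed
  hence "(\<lambda>N. iexp (\<theta> N)) \<longlonglongrightarrow> iexp 0" by (intro tendsto_intros)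
  hence main: "(\<lambda>N. exp (- t\<^sup>2 / 2) * iexp (\<theta> N)) \<longlonglongrightarrow> exp (- t\<^sup>2 / 2) * iexp 0"
    by (intro tendsto_mult tendsto_const)
  have "(\<lambda>N. measure_pmf.expectation (M N) (\<lambda>s. iexp (t / sqrt (total_var N) * fst s)) - exp (- t\<^sup>2 / 2) * iexp (\<theta> N)) \<longlonglongrightarrow> 0"
  proof (rule Lim_null_comparison)
    show "eventually (\<lambda>N. cmod (measure_pmf.expectation (M N) (\<lambda>s. iexp (t / sqrt (total_var N) * fst s)) - exp (- t\<^sup>2 / 2) * iexp (\<theta> N))
      \<le> \<bar>t\<bar> ^ 3 * coeff_const / 3 * sqrt ((1 + G N)\<^sup>2 / total_var N) + t\<^sup>2 / 2 * ((\<Sum>j\<in>{1..<N}. step_var (fcoeff N (Suc j)) * rel_moment j) / total_var N)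
       + t ^ 4 * coeff_const\<^sup>2 / 8 * ((1 + G N)\<^sup>2 / total_var N)) sequentially"
      using eventually_ge_at_top[of 1] pos
      by eventually_elim (unfold \<theta>_def, rule char_final_bound, use G in auto)
    have "(\<lambda>N. \<bar>t\<bar> ^ 3 * coeff_const / 3 * sqrt ((1 + G N)\<^sup>2 / total_var N) + t\<^sup>2 / 2 * ((\<Sum>j\<in>{1..<N}. step_var (fcoeff N (Suc j)) * rel_moment j) / total_var N)
       + t ^ 4 * coeff_const\<^sup>2 / 8 * ((1 + G N)\<^sup>2 / total_var N)) \<longlonglongrightarrow> \<bar>t\<bar> ^ 3 * coeff_const / 3 * sqrt 0 + t\<^sup>2 / 2 * 0 + t ^ 4 * coeff_const\<^sup>2 / 8 * 0"
      by (intro tendsto_add tendsto_mult[OF tendsto_const] sq avg negl)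
    thus "(\<lambda>N. \<bar>t\<bar> ^ 3 * coeff_const / 3 * sqrt ((1 + G N)\<^sup>2 / total_var N) + t\<^sup>2 / 2 * ((\<Sum>j\<in>{1..<N}. step_var (fcoeff N (Suc j)) * rel_moment j) / total_var N)
       + t ^ 4 * coeff_const\<^sup>2 / 8 * ((1 + G N)\<^sup>2 / total_var N)) \<longlonglongrightarrow> 0" by simp
  qed
  from tendsto_add[OF this main] show ?thesis by simp
qed

section \<open>No single coefficient dominates\<close>

text \<open>If \<open>\<rho> \<le> 0\<close>, then the mean of \<open>w\<close> does not grow, so that the drift of \<open>y\<close> at time \<open>l\<close> is at most
\<open>1 / D l\<close>. Here \<open>\<rho> \<ge> -2\<close> ensures that the factor \<open>1 + \<rho> / D l\<close> is not below \<open>-1\<close>, even for \<open>l = 1\<close>.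
If \<open>\<mu> = 0\<close>, then colors of children are fair coins and there is no drift of \<open>y\<close> at all.\<close>

lemma fcoeff_le_sum_inverse_D:
  assumes "\<rho> \<le> 0 \<or> \<mu> = 0" "1 \<le> k"
  shows "\<bar>fcoeff N k\<bar> \<le> (\<Sum>l\<in>{k..<N}. 1 / D l)"
proof (cases "\<mu> = 0")
  case True
  have "0 \<le> (\<Sum>l\<in>{k..<N}. 1 / D l)"
    using assms(2) by (intro sum_nonneg) (auto simp: less_imp_le[OF D_pos])
  thus ?thesis using True by (simp add: fcoeff_def)
next
  case False
  hence \<rho>: "\<rho> \<le> 0" using assms(1) by simp
  have factor: "\<bar>1 + \<rho> / D l\<bar> \<le> 1" if "l \<ge> 1" for l
  proof -
    have "-2 * D l \<le> \<rho>" using D_ge_1[OF that] drift_lower by (simp add: \<rho>_def \<mu>_def)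
    hence "-2 \<le> \<rho> / D l" "\<rho> / D l \<le> 0"
      using D_pos[OF that] \<rho> by (auto simp: pos_le_divide_eq divide_nonpos_pos)
    thus ?thesis by simp
  qed
  have "\<bar>growth N l\<bar> \<le> 1" if "l \<ge> 1" for l
    unfolding growth_def abs_prod using factor that by (intro prod_le_1) auto
  hence "\<bar>growth N (Suc l) / D l\<bar> \<le> 1 / D l" if "l \<in> {k..<N}" for l
    using D_pos[of l] assms(2) that by (auto simp: abs_divide intro!: divide_right_mono)
  hence "\<bar>\<Sum>l\<in>{k..<N}. growth N (Suc l) / D l\<bar> \<le> (\<Sum>l\<in>{k..<N}. 1 / D l)"
    by (intro order_trans[OF sum_abs] sum_mono)
  hence "\<bar>\<mu>\<bar> * \<bar>\<Sum>l\<in>{k..<N}. growth N (Suc l) / D l\<bar> \<le> 1 * (\<Sum>l\<in>{k..<N}. 1 / D l)"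
    using mu_bound by (intro mult_mono) auto
  thus ?thesis by (simp add: fcoeff_def abs_mult)
qed

text \<open>In the last fraction \<open>1 / r\<close> of the time there are not enough steps left for the coefficients of the
forecasts to become large, so that each of these increments has a variance of at least \<open>1 / 4\<close>.\<close>

lemma total_var_ge_linear:
  assumes "\<rho> \<le> 0 \<or> \<mu> = 0"
  obtains r :: nat where "r \<ge> 2" "\<And>N. N \<ge> 1 \<Longrightarrow> real (N div r) / 4 \<le> total_var N"
proof -
  define x where "x = coeff_const / \<gamma>"
  obtain r0 :: nat where r0: "2 * x \<le> real r0" using real_arch_simple by blast
  \<comment> \<open>The factor \<open>r - 1\<close> must beat \<open>2 * coeff_const / \<gamma>\<close> below, and \<open>r \<ge> 2\<close> keeps \<open>N - N div r\<close> positive.\<close>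
  define r where "r = r0 + 2"
  have r: "r \<ge> 2" "x \<le> (real r - 1) / 2" using r0 by (auto simp: r_def)
  have "real (N div r) / 4 \<le> total_var N" if N: "N \<ge> 1" for N
  proof -
    define k where "k = N div r"
    have rk: "r * k \<le> N" by (simp add: k_def)
    moreover have "2 * k \<le> r * k" using r(1) by (rule mult_right_mono) simp
    ultimately have k: "k < N" using N by linarith
    have "1 / 4 \<le> step_var (fcoeff N (Suc j))" if j: "j \<in> {N - k..<N}" for j
    proof (rule step_var_lower)
      have "real r * real k \<le> real N" using rk by (metis of_nat_le_iff of_nat_mult)
      moreover have "real N - real k \<le> real j" using j k by auto
      ultimately have kj: "(real r - 1) * real k \<le> real j" by (simp add: algebra_simps)
      have j0: "real j > 0" using j k by auto
      have \<gamma>: "\<gamma> > 0" using gamma_pos .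
      have "\<bar>fcoeff N (Suc j)\<bar> \<le> (\<Sum>l\<in>{Suc j..<N}. 1 / D l)"
        by (rule fcoeff_le_sum_inverse_D[OF assms]) simp
      also have "\<dots> \<le> (\<Sum>l\<in>{Suc j..<N}. 1 / (\<gamma> * real j))"
      proof (rule sum_mono)
        fix l assume l: "l \<in> {Suc j..<N}"
        have "\<gamma> * real j \<le> \<gamma> * (real l - 1)" using l \<gamma> by (intro mult_left_mono) auto
        hence "\<gamma> * real j \<le> D l" by (simp add: D_eq)
        thus "1 / D l \<le> 1 / (\<gamma> * real j)"
          using \<gamma> j0 by (intro divide_left_mono mult_pos_pos D_pos) (use l in auto)
      qed
      also have "\<dots> = real (N - Suc j) / (\<gamma> * real j)" by simp
      also have "\<dots> \<le> real k / (\<gamma> * real j)"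
        using j j0 \<gamma> by (intro divide_right_mono) auto
      finally have "\<bar>fcoeff N (Suc j)\<bar> * coeff_const \<le> real k / (\<gamma> * real j) * coeff_const"
        using coeff_const_ge_1 by (intro mult_right_mono) auto
      also have "\<dots> = x * real k / real j" by (simp add: x_def)
      also have "\<dots> \<le> ((real r - 1) / 2) * real k / real j"
        using r(2) j0 by (intro divide_right_mono mult_right_mono) auto
      also have "\<dots> \<le> 1 / 2" using kj j0 by (simp add: pos_divide_le_eq)
      finally show "\<bar>fcoeff N (Suc j)\<bar> * coeff_const \<le> 1 / 2" .
    qed
    hence "(\<Sum>j\<in>{N - k..<N}. 1 / 4) \<le> (\<Sum>j\<in>{N - k..<N}. step_var (fcoeff N (Suc j)))" by (rule sum_mono)
    also have "\<dots> \<le> total_var N" unfolding total_var_def using k by (intro sum_mono2) (auto simp: step_var_nonneg)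
    finally show ?thesis using k by (simp add: k_def)
  qed
  thus ?thesis using that r by blast
qed

text \<open>The coefficients are at most logarithmic and the variance is at least linear.\<close>

lemma negligible_nonpos:
  assumes "\<rho> \<le> 0 \<or> \<mu> = 0"
  defines "G \<equiv> \<lambda>N. (1 + ln (real N)) / \<delta>"
  shows "\<And>N k. k \<in> {1..N} \<Longrightarrow> \<bar>fcoeff N k\<bar> \<le> G N"
    and "eventually (\<lambda>N. total_var N > 0) sequentially"
    and "(\<lambda>N. (1 + G N)\<^sup>2 / total_var N) \<longlonglongrightarrow> 0"
proof -
  show "\<bar>fcoeff N k\<bar> \<le> G N" if "k \<in> {1..N}" for N k
  proof -
    have "\<bar>fcoeff N k\<bar> \<le> (\<Sum>l\<in>{k..<N}. 1 / D l)" using fcoeff_le_sum_inverse_D assms that by simp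
    also have "\<dots> \<le> (\<Sum>l\<in>{1..<N}. 1 / D l)"
      using that by (intro sum_mono2) (auto simp: less_imp_le[OF D_pos])
    also have "\<dots> \<le> G N" unfolding G_def by (rule sum_inverse_D) (use that in auto)
    finally show ?thesis .
  qed
  obtain r :: nat where r: "r \<ge> 2" "\<And>N. N \<ge> 1 \<Longrightarrow> real (N div r) / 4 \<le> total_var N"
    using total_var_ge_linear[OF assms(1)] by blast
  have R: "real N / real r - 1 \<le> 4 * total_var N" if "N \<ge> 1" for N
  proof -
    have "real N < real (r + r * (N div r))"
      unfolding of_nat_less_iff using r(1) by (intro dividend_less_times_div) simp
    hence "real N / real r < 1 + real (N div r)"
      using r(1) by (simp add: divide_less_eq algebra_simps)
    thus ?thesis using r(2)[OF that] by linarith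
  qed
  have pos: "eventually (\<lambda>N. real N / real r - 1 > 0) sequentially"
    using r(1) by real_asymp
  show "eventually (\<lambda>N. total_var N > 0) sequentially"
    using pos eventually_ge_at_top[of 1] by eventually_elim (use R in fastforce)
  show "(\<lambda>N. (1 + G N)\<^sup>2 / total_var N) \<longlonglongrightarrow> 0"
  proof (rule tendsto_sandwich[of "\<lambda>_. 0"])
    show "eventually (\<lambda>N. (1 + G N)\<^sup>2 / total_var N \<le> 4 * (1 + G N)\<^sup>2 / (real N / real r - 1)) sequentially"
      using pos eventually_ge_at_top[of 1]
    proof eventually_elim
      case (elim N)
      have "(1 + G N)\<^sup>2 / total_var N = 4 * (1 + G N)\<^sup>2 / (4 * total_var N)" by simp
      also have "\<dots> \<le> 4 * (1 + G N)\<^sup>2 / (real N / real r - 1)"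
        using R[OF elim(2)] elim(1) by (intro divide_left_mono mult_pos_pos) auto
      finally show ?case .
    qed
    show "(\<lambda>N. 4 * (1 + G N)\<^sup>2 / (real N / real r - 1)) \<longlonglongrightarrow> 0"
      unfolding G_def using r(1) delta_pos by real_asymp
  qed (auto simp: total_var_nonneg)
qed

definition full_growth :: "nat \<Rightarrow> real" where "full_growth n = (\<Prod>l\<in>{1..<n}. 1 + \<rho> / D l)"

lemma full_growth_split:
  assumes "1 \<le> k" "k \<le> N"
  shows "full_growth N = full_growth k * growth N k"
proof -
  have "{1..<N} = {1..<k} \<union> {k..<N}" using assms by auto
  thus ?thesis unfolding full_growth_def growth_def by (simp add: prod.union_disjoint ivl_disj_int)
qed

lemma full_growth_ge_1: "\<rho> > 0 \<Longrightarrow> full_growth n \<ge> 1"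
  unfolding full_growth_def by (intro prod_ge_1) (auto simp: less_imp_le[OF D_pos])

lemma growth_ge_1: "\<rho> > 0 \<Longrightarrow> 1 \<le> k \<Longrightarrow> growth N k \<ge> 1"
  unfolding growth_def by (intro prod_ge_1) (auto simp: less_imp_le[OF D_pos])

text \<open>The growth of the mean of \<open>w\<close> is at most of the order of \<open>sqrt (D n)\<close>. The shift by \<open>\<gamma> / 4\<close> makes
the induction work in the boundary case \<open>2 * \<rho> = \<gamma>\<close>: with \<open>x = \<gamma> / D n\<close> the factor
\<open>(1 + x / 2)\<^sup>2 = 1 + x + x\<^sup>2 / 4\<close> is slightly larger than \<open>D (Suc n) / D n\<close>, and the shift absorbs the
quadratic term. It starts at \<open>2\<close>, since \<open>D 1 - \<gamma> / 4\<close> may be negative.\<close>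

lemma full_growth_square_le:
  assumes \<rho>: "\<rho> > 0" and "2 \<le> n"
  shows "(full_growth n)\<^sup>2 \<le> (1 + \<rho>)\<^sup>2 * (D n - \<gamma> / 4)"
  using assms(2)
proof (induction n rule: nat_induct_at_least)
  case base
  have "full_growth 2 = 1 + \<rho>" by (simp add: full_growth_def numeral_2_eq_2 D_eq)
  moreover have "(1 + \<rho>)\<^sup>2 * 1 \<le> (1 + \<rho>)\<^sup>2 * (D 2 - \<gamma> / 4)"
  proof (rule mult_left_mono)
    have "D 2 = 1 + \<gamma>" by (simp add: D_eq)
    moreover have "\<gamma> / 4 \<le> \<gamma>" using gamma_pos by simp
    ultimately show "1 \<le> D 2 - \<gamma> / 4" by simp
  qed simp
  ultimately show ?case by simp
next
  case (Suc n)
  have D: "D n > 0" "D n \<ge> 1" "D n \<ge> 1 + \<gamma>"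
  proof -
    have "\<gamma> * 1 \<le> \<gamma> * (real n - 1)" using Suc.hyps gamma_pos by (intro mult_left_mono) auto
    thus "D n \<ge> 1 + \<gamma>" by (simp add: D_eq)
    thus "D n \<ge> 1" "D n > 0" using gamma_pos by linarith+
  qed
  have pos: "0 \<le> D n - \<gamma> / 4" using D gamma_pos by simp
  have rec: "full_growth (Suc n) = full_growth n * (1 + \<rho> / D n)"
    using Suc.hyps by (simp add: full_growth_def)
  define x where "x = \<gamma> / D n"
  have x: "x \<ge> 0" "D n * x = \<gamma>" using D gamma_pos by (simp_all add: x_def)
  have "\<rho> / D n \<le> x / 2" using rho_le D by (simp add: x_def field_simps)
  hence "(1 + \<rho> / D n)\<^sup>2 \<le> (1 + x / 2)\<^sup>2"
    using \<rho> D by (intro power_mono) auto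
  hence "(full_growth n)\<^sup>2 * (1 + \<rho> / D n)\<^sup>2 \<le> ((1 + \<rho>)\<^sup>2 * (D n - \<gamma> / 4)) * (1 + x / 2)\<^sup>2"
    using Suc.IH pos by (intro mult_mono) auto
  also have "\<dots> = (1 + \<rho>)\<^sup>2 * ((D n - \<gamma> / 4) * (1 + x / 2)\<^sup>2)" by (rule mult.assoc)
  also have "\<dots> \<le> (1 + \<rho>)\<^sup>2 * (D (Suc n) - \<gamma> / 4)"
  proof (rule mult_left_mono)
    have "(D n - D n * x / 4) * (1 + x / 2)\<^sup>2 = D n + D n * x - D n * x / 4 - D n * x * x\<^sup>2 / 16"
      by (simp add: power2_eq_square field_simps)
    moreover have "0 \<le> D n * x * x\<^sup>2 / 16" using D x(1) by simp
    ultimately show "(D n - \<gamma> / 4) * (1 + x / 2)\<^sup>2 \<le> D (Suc n) - \<gamma> / 4"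
      unfolding D_Suc x(2)[symmetric] by linarith
  qed simp
  finally show ?case unfolding rec power_mult_distrib .
qed

text \<open>All coefficients are at most of the order of \<open>full_growth N\<close>. The variance of the increment at time
\<open>j\<close> is at least \<open>(\<mu> * growth N (Suc j))\<^sup>2\<close>, and \<open>growth N (Suc j)\<close> is the quotient of \<open>full_growth N\<close> by
\<open>full_growth (Suc j)\<close>. Since the latter is at most of the order of \<open>sqrt j\<close>, the total variance exceeds
\<open>(full_growth N)\<^sup>2\<close> by a factor of the order of the harmonic sum \<open>ln N\<close>. In the boundary case
\<open>2 * \<rho> = \<gamma>\<close> this logarithm is all that there is to gain.\<close>

lemma negligible_pos:
  assumes \<rho>: "\<rho> > 0" and \<mu>: "\<mu> \<noteq> 0"
  defines "G \<equiv> \<lambda>N. full_growth N / \<rho>"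
  shows "\<And>N k. k \<in> {1..N} \<Longrightarrow> \<bar>fcoeff N k\<bar> \<le> G N"
    and "eventually (\<lambda>N. total_var N > 0) sequentially"
    and "(\<lambda>N. (1 + G N)\<^sup>2 / total_var N) \<longlonglongrightarrow> 0"
proof -
  show "\<bar>fcoeff N k\<bar> \<le> G N" if k: "k \<in> {1..N}" for N k
  proof -
    have g1: "growth N k \<ge> 1" using growth_ge_1 \<rho> k by simp
    have "1 * growth N k \<le> full_growth k * growth N k"
      using full_growth_ge_1[OF \<rho>] g1 by (intro mult_right_mono) auto
    also have "\<dots> = full_growth N" using full_growth_split[of k N] k by simp
    finally have g: "\<bar>growth N k - 1\<bar> \<le> full_growth N" using g1 by simp
    have "fcoeff N k = \<mu> * (growth N k - 1) / \<rho>"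
      using drift_fcoeff[of k N] k \<rho> by (simp add: field_simps)
    hence "\<bar>fcoeff N k\<bar> = \<bar>\<mu>\<bar> * \<bar>growth N k - 1\<bar> / \<rho>" using \<rho> by (simp add: abs_mult)
    also have "\<dots> \<le> 1 * full_growth N / \<rho>"
      using mu_bound g \<rho> by (intro divide_right_mono mult_mono) auto
    finally show ?thesis by (simp add: G_def)
  qed
  define K where "K = (1 + \<rho>)\<^sup>2 * (1 + \<gamma>)"
  have K: "K > 0" unfolding K_def using \<rho> gamma_pos by (intro mult_pos_pos) auto
  have lower: "\<mu>\<^sup>2 * (full_growth N)\<^sup>2 / K * ln (real N) \<le> total_var N" if N: "N \<ge> 1" for N
  proof -
    have "\<mu>\<^sup>2 * (full_growth N)\<^sup>2 / K * inverse (real j) \<le> step_var (fcoeff N (Suc j))" if j: "j \<in> {1..<N}" for j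
    proof -
      have "(full_growth (Suc j))\<^sup>2 \<le> (1 + \<rho>)\<^sup>2 * (D (Suc j) - \<gamma> / 4)" using full_growth_square_le \<rho> j by simp
      also have "\<dots> \<le> (1 + \<rho>)\<^sup>2 * ((1 + \<gamma>) * real j)"
        using gamma_pos j by (intro mult_left_mono) (auto simp: D_eq algebra_simps)
      finally have le: "(full_growth (Suc j))\<^sup>2 \<le> K * real j" by (simp add: K_def mult.assoc)
      have "(full_growth N)\<^sup>2 / (K * real j) \<le> (full_growth N)\<^sup>2 / (full_growth (Suc j))\<^sup>2"
        using le full_growth_ge_1[OF \<rho>, of "Suc j"] K j by (intro divide_left_mono) (auto intro!: mult_pos_pos)
      also have "\<dots> = (growth N (Suc j))\<^sup>2"
        using full_growth_split[of "Suc j" N] full_growth_ge_1[OF \<rho>, of "Suc j"] j by (simp add: power_mult_distrib)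
      finally have "\<mu>\<^sup>2 * ((full_growth N)\<^sup>2 / (K * real j)) \<le> \<mu>\<^sup>2 * (growth N (Suc j))\<^sup>2" by (rule mult_left_mono) simp
      also have "\<dots> = (\<mu> + \<rho> * fcoeff N (Suc j))\<^sup>2"
        using drift_fcoeff[of "Suc j" N] j by (simp add: power_mult_distrib)
      also have "\<dots> \<le> step_var (fcoeff N (Suc j))" by (rule step_var_ge)
      finally show ?thesis by (simp add: field_simps)
    qed
    hence "(\<Sum>j\<in>{1..<N}. \<mu>\<^sup>2 * (full_growth N)\<^sup>2 / K * inverse (real j)) \<le> total_var N"
      unfolding total_var_def by (rule sum_mono)
    moreover have "(\<Sum>j\<in>{1..<N}. inverse (real j)) = harm (N - 1)"
      unfolding harm_def by (rule sum.cong) (use N in auto)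
    ultimately have "\<mu>\<^sup>2 * (full_growth N)\<^sup>2 / K * harm (N - 1) \<le> total_var N"
      by (simp only: sum_distrib_left[symmetric])
    moreover have "ln (real N) \<le> harm (N - 1)"
      using ln_le_harm[of "N - 1"] N by (simp add: of_nat_diff)
    hence "\<mu>\<^sup>2 * (full_growth N)\<^sup>2 / K * ln (real N) \<le> \<mu>\<^sup>2 * (full_growth N)\<^sup>2 / K * harm (N - 1)"
      by (rule mult_left_mono) (use K in simp)
    ultimately show ?thesis by linarith
  qed
  have N3: "eventually (\<lambda>N::nat. N \<ge> 3) sequentially" by (rule eventually_ge_at_top)
  show "eventually (\<lambda>N. total_var N > 0) sequentially"
    using N3
  proof eventually_elim
    case (elim N)
    have "0 < \<mu>\<^sup>2 * (full_growth N)\<^sup>2 / K * ln (real N)"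
      using \<mu> full_growth_ge_1[OF \<rho>, of N] K elim by (intro mult_pos_pos divide_pos_pos) auto
    thus ?case using lower[of N] elim by simp
  qed
  show "(\<lambda>N. (1 + G N)\<^sup>2 / total_var N) \<longlonglongrightarrow> 0"
  proof (rule tendsto_sandwich[of "\<lambda>_. 0"])
    show "eventually (\<lambda>N. (1 + G N)\<^sup>2 / total_var N \<le> (1 + 1 / \<rho>)\<^sup>2 * K / \<mu>\<^sup>2 / ln (real N)) sequentially"
      using N3
    proof eventually_elim
      case (elim N)
      have P: "full_growth N \<ge> 1" by (rule full_growth_ge_1[OF \<rho>])
      have pos: "0 < \<mu>\<^sup>2 * (full_growth N)\<^sup>2 / K * ln (real N)"
        using \<mu> P K elim by (intro mult_pos_pos divide_pos_pos) auto
      have "1 + G N \<le> full_growth N * (1 + 1 / \<rho>)" using P \<rho> by (simp add: G_def algebra_simps)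
      hence "(1 + G N)\<^sup>2 \<le> (full_growth N * (1 + 1 / \<rho>))\<^sup>2"
        using P \<rho> by (intro power_mono) (auto simp: G_def)
      hence "(1 + G N)\<^sup>2 / total_var N \<le> (full_growth N * (1 + 1 / \<rho>))\<^sup>2 / (\<mu>\<^sup>2 * (full_growth N)\<^sup>2 / K * ln (real N))"
        using lower[of N] elim pos by (intro frac_le) auto
      also have "\<dots> = (1 + 1 / \<rho>)\<^sup>2 * K / \<mu>\<^sup>2 / ln (real N)"
        using P K \<mu> by (simp add: power_mult_distrib)
      finally show ?case .
    qed
    show "(\<lambda>N. (1 + 1 / \<rho>)\<^sup>2 * K / \<mu>\<^sup>2 / ln (real N)) \<longlonglongrightarrow> 0"
      by real_asymp
  qed (auto simp: total_var_nonneg)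
qed

lemma negligible:
  obtains G where "\<And>N k. k \<in> {1..N} \<Longrightarrow> \<bar>fcoeff N k\<bar> \<le> G N"
    and "eventually (\<lambda>N. total_var N > 0) sequentially"
    and "(\<lambda>N. (1 + G N)\<^sup>2 / total_var N) \<longlonglongrightarrow> 0"
proof (cases "\<rho> > 0 \<and> \<mu> \<noteq> 0")
  case True
  hence "\<rho> > 0" "\<mu> \<noteq> 0" by auto
  from that[OF negligible_pos[OF this]] show ?thesis .
next
  case False
  hence "\<rho> \<le> 0 \<or> \<mu> = 0" by auto
  from that[OF negligible_nonpos[OF this]] show ?thesis .
qed

section \<open>The sign of the color sum\<close>

text \<open>The case \<open>a = -1\<close> serves to control \<open>\<P>(y \<ge> 0)\<close>. The normal law has no atom at \<open>0\<close>, so that weak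
convergence yields convergence of the distribution functions at \<open>0\<close>.\<close>

lemma weak_limit:
  assumes "a \<in> {1, -1}"
  shows "(\<lambda>N. measure_pmf.prob (M N) {s. a * fst s \<le> 0}) \<longlonglongrightarrow> cdf std_normal_distribution 0"
proof -
  obtain G where G: "\<And>N k. k \<in> {1..N} \<Longrightarrow> \<bar>fcoeff N k\<bar> \<le> G N"
    and pos: "eventually (\<lambda>N. total_var N > 0) sequentially"
    and negl: "(\<lambda>N. (1 + G N)\<^sup>2 / total_var N) \<longlonglongrightarrow> 0"
    by (rule negligible) blast
  define X where "X = (\<lambda>N (s :: real \<times> real). a * fst s / sqrt (total_var N))"
  have a2: "a\<^sup>2 = 1" using assms by auto
  have "weak_conv_m (\<lambda>N. distr (M N) borel (X N)) std_normal_distribution"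
  proof (rule levy_continuity)
    show "real_distribution (distr (M N) borel (X N))" for N
      by (rule prob_space.real_distribution_distr) (auto simp: measure_pmf.prob_space_axioms)
    show "real_distribution std_normal_distribution" by (rule real_dist_normal_dist)
    fix t :: real
    have "char (distr (M N) borel (X N)) t = measure_pmf.expectation (M N) (\<lambda>s. iexp ((a * t) * (fst s / sqrt (total_var N))))" for N
      by (simp add: char_def integral_distr X_def mult_ac)
    thus "(\<lambda>N. char (distr (M N) borel (X N)) t) \<longlonglongrightarrow> char std_normal_distribution t"
      using char_tendsto[OF G pos negl, of "a * t"] by (simp add: char_std_normal_distribution power_mult_distrib a2)
  qed
  moreover have "isCont (cdf std_normal_distribution) 0"
  proof -
    interpret N: real_distribution std_normal_distribution by (rule real_dist_normal_dist)
    have "emeasure std_normal_distribution {0} = 0"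
      by (subst emeasure_density) (auto simp: nn_integral_cmult_indicator)
    thus ?thesis by (simp add: N.isCont_cdf measure_def)
  qed
  ultimately have "(\<lambda>N. cdf (distr (M N) borel (X N)) 0) \<longlonglongrightarrow> cdf std_normal_distribution 0"
    by (simp add: weak_conv_m_def weak_conv_def)
  moreover have "eventually (\<lambda>N. cdf (distr (M N) borel (X N)) 0 = measure_pmf.prob (M N) {s. a * fst s \<le> 0}) sequentially"
    using pos
  proof eventually_elim
    case (elim N)
    have "X N -` {..0} = {s. a * fst s \<le> 0}"
      using elim by (auto simp: X_def divide_le_0_iff)
    thus ?case by (simp add: cdf_def measure_distr)
  qed
  ultimately show ?thesis by (rule Lim_transform_eventually)
qed

theorem sign_forgets_start:
  "(\<lambda>N. (measure_pmf.prob (M N) {s. fst s < 0} + measure_pmf.prob (M N) {s. fst s \<le> 0}) / 2) \<longlonglongrightarrow> 1 / 2"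
proof -
  have "{s :: real \<times> real. fst s < 0} = - {s. -1 * fst s \<le> 0}" by auto
  hence *: "measure_pmf.prob (M N) {s. fst s < 0} = 1 - measure_pmf.prob (M N) {s. -1 * fst s \<le> 0}" for N
    using measure_pmf.prob_compl[of "{s. -1 * fst s \<le> 0}" "M N"] by (simp add: Compl_eq_Diff_UNIV)
  have "(\<lambda>N. (1 - measure_pmf.prob (M N) {s. -1 * fst s \<le> 0} + measure_pmf.prob (M N) {s. 1 * fst s \<le> 0}) / 2)
     \<longlonglongrightarrow> (1 - cdf std_normal_distribution 0 + cdf std_normal_distribution 0) / 2"
    by (intro tendsto_intros weak_limit) auto
  thus ?thesis unfolding * by simp
qed

end

section \<open>From the broadcasting process to the urn\<close>

text \<open>The attachment weight of a vertex without children (other than the root): in a shape exchangeable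
tree its edge to the parent already counts.\<close>

fun child_weight :: "tree_model \<Rightarrow> real \<Rightarrow> real" where
  "child_weight Very_Simple_Increasing \<alpha> = 1"
| "child_weight Shape_Exchangeable \<alpha> = \<alpha> + 1"

fun weight :: "tree_model \<Rightarrow> real \<Rightarrow> nat \<Rightarrow> (nat \<Rightarrow> nat) \<Rightarrow> nat \<Rightarrow> real" where
  "weight Very_Simple_Increasing \<alpha> n p v = \<alpha> * real (outdeg n p v) + 1"
| "weight Shape_Exchangeable \<alpha> n p v = \<alpha> * real (deg n p v) + 1"

lemma attach_prob_eq_weight:
  "attach_prob m \<alpha> n p v = weight m \<alpha> n p v / mass \<alpha> (child_weight m \<alpha>) n"
  by (cases m) (simp_all add: mass_def algebra_simps)

lemma mass_pos:
  assumes "\<alpha> \<in> allowed_params m" "n \<ge> 1"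
  shows "mass \<alpha> (child_weight m \<alpha>) n > 0"
  using denom_pos[OF assms] by (cases m) (simp_all add: mass_def algebra_simps)

lemma attach_weight_step:
  assumes "is_tree n p" "v \<in> {1..n}" "w \<in> {1..Suc n}"
  shows "weight m \<alpha> (Suc n) (p(Suc n := v)) w =
    (if w = Suc n then child_weight m \<alpha> else weight m \<alpha> n p w + (if w = v then \<alpha> else 0))"
proof (cases m)
  case Very_Simple_Increasing
  thus ?thesis using outdeg_step[OF assms] by (simp add: algebra_simps)
next
  case Shape_Exchangeable
  have n: "n \<ge> 1" using assms(2) by simp
  have "deg (Suc n) (p(Suc n := v)) w = (if w = Suc n then 1 else deg n p w + (if w = v then 1 else 0))"
    using outdeg_step[OF assms] deg_eq[OF is_tree_step[OF assms(1,2)] assms(3)] deg_eq[OF assms(1), of w] assms(3) n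
    by auto
  thus ?thesis using Shape_Exchangeable by (simp add: algebra_simps)
qed

definition colors_ok :: "nat \<Rightarrow> (nat \<Rightarrow> int) \<Rightarrow> bool" where
  "colors_ok n B \<longleftrightarrow> (\<forall>v\<in>{1..n}. B v \<in> {-1, 1})"

lemma colors_okD: "colors_ok n B \<Longrightarrow> v \<in> {1..n} \<Longrightarrow> B v \<in> {-1, 1}"
  unfolding colors_ok_def by blast

text \<open>Multiplying by the root color \<open>B 1\<close> makes the law independent of the root color, and the majority
vote is wrong when this number is negative.\<close>

definition color_sum :: "nat \<Rightarrow> (nat \<Rightarrow> int) \<Rightarrow> real" where
  "color_sum n B = of_int (B 1 * (\<Sum>v\<in>{1..n}. B v))"

definition weighted_color_sum :: "tree_model \<Rightarrow> real \<Rightarrow> nat \<Rightarrow> (nat \<Rightarrow> nat) \<Rightarrow> (nat \<Rightarrow> int) \<Rightarrow> real" where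
  "weighted_color_sum m \<alpha> n p B = of_int (B 1) * (\<Sum>v\<in>{1..n}. weight m \<alpha> n p v * of_int (B v))"

definition urn_state :: "tree_model \<Rightarrow> real \<Rightarrow> nat \<Rightarrow> (nat \<Rightarrow> nat) \<times> (nat \<Rightarrow> int) \<Rightarrow> real \<times> real" where
  "urn_state m \<alpha> n = (\<lambda>(p, B). (color_sum n B, weighted_color_sum m \<alpha> n p B))"

definition urn :: "tree_model \<Rightarrow> real \<Rightarrow> real \<Rightarrow> nat \<Rightarrow> (real \<times> real) pmf" where
  "urn m \<alpha> q n = map_pmf (urn_state m \<alpha> n) (broadcast m \<alpha> q n)"

lemma broadcast_Suc:
  assumes "n \<ge> 1"
  shows "broadcast m \<alpha> q (Suc n) =
     do {
       (p, B) \<leftarrow> broadcast m \<alpha> q n;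
       v \<leftarrow> attachment m \<alpha> n p;
       flip \<leftarrow> bernoulli_pmf q;
       return_pmf (p(Suc n := v), B(Suc n := (if flip then - B v else B v)))
     }"
  using assms by (cases n) simp_all

lemma set_attachment:
  assumes "\<alpha> \<in> allowed_params m" "n \<ge> 1" "attachable m \<alpha> n p"
  shows "set_pmf (attachment m \<alpha> n p) \<subseteq> {1..n}"
  using pmf_attachment_aux[OF assms] by (auto simp: set_pmf_iff split: if_splits)

lemma colors_ok_broadcast:
  assumes "\<alpha> \<in> allowed_params m" "n \<ge> 1" "(p, B) \<in> set_pmf (broadcast m \<alpha> q n)"
  shows "colors_ok n B"
  using assms(2,3)
proof (induction n arbitrary: p B rule: nat_induct_at_least)
  case base
  thus ?case by (auto simp: colors_ok_def)
next
  case (Suc n)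
  from Suc.prems obtain p' B' v f where pB: "(p', B') \<in> set_pmf (broadcast m \<alpha> q n)"
    and v: "v \<in> set_pmf (attachment m \<alpha> n p')" and B: "B = B'(Suc n := (if f then - B' v else B' v))"
    unfolding broadcast_Suc[OF Suc.hyps] by (auto simp: set_bind_pmf)
  have "v \<in> {1..n}"
    using set_attachment[OF assms(1) Suc.hyps attachable_broadcast[OF assms(1) Suc.hyps pB]] v by blast
  moreover have "colors_ok n B'" using Suc.IH pB by blast
  ultimately show ?case unfolding B by (auto simp: colors_ok_def le_Suc_eq)
qed

lemma sum_weight:
  assumes "\<alpha> \<in> allowed_params m" "n \<ge> 1" "is_tree n p"
  shows "(\<Sum>v\<in>{1..n}. weight m \<alpha> n p v) = mass \<alpha> (child_weight m \<alpha>) n"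
  using sum_attach_prob[OF assms] mass_pos[OF assms(1,2)]
  by (simp add: attach_prob_eq_weight sum_divide_distrib[symmetric])

lemma weight_nonneg:
  assumes "\<alpha> \<in> allowed_params m" "n \<ge> 1" "attachable m \<alpha> n p" "v \<in> {1..n}"
  shows "weight m \<alpha> n p v \<ge> 0"
  using assms(3,4) mass_pos[OF assms(1,2)]
  by (auto simp: attachable_def attach_prob_eq_weight zero_le_divide_iff)

lemma weighted_color_sum_bound:
  assumes "\<alpha> \<in> allowed_params m" "n \<ge> 1" "attachable m \<alpha> n p" "colors_ok n B"
  shows "\<bar>weighted_color_sum m \<alpha> n p B\<bar> \<le> mass \<alpha> (child_weight m \<alpha>) n"
proof -
  have B: "\<bar>real_of_int (B v)\<bar> = 1" if "v \<in> {1..n}" for v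
    using colors_okD[OF assms(4) that] by auto
  have "\<bar>weighted_color_sum m \<alpha> n p B\<bar> = \<bar>\<Sum>v\<in>{1..n}. weight m \<alpha> n p v * of_int (B v)\<bar>"
    using B[of 1] assms(2) by (simp add: weighted_color_sum_def abs_mult)
  also have "\<dots> \<le> (\<Sum>v\<in>{1..n}. \<bar>weight m \<alpha> n p v * of_int (B v)\<bar>)" by (rule sum_abs)
  also have "\<dots> = (\<Sum>v\<in>{1..n}. weight m \<alpha> n p v)"
    using B weight_nonneg[OF assms(1-3)] by (intro sum.cong) (auto simp: abs_mult)
  also have "\<dots> = mass \<alpha> (child_weight m \<alpha>) n"
    using sum_weight assms by (simp add: attachable_def)
  finally show ?thesis .
qed

text \<open>The indicator of \<open>B v = B 1\<close> is \<open>(1 + B 1 * B v) / 2\<close>. Averaging it with the attachment probabilities,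
which are the weights divided by their sum, gives the claim.\<close>

lemma relative_color_of_parent:
  assumes "\<alpha> \<in> allowed_params m" "n \<ge> 1" "attachable m \<alpha> n p" "colors_ok n B"
  shows "map_pmf (\<lambda>v. B v = B 1) (attachment m \<alpha> n p) =
    bernoulli_pmf ((1 + weighted_color_sum m \<alpha> n p B / mass \<alpha> (child_weight m \<alpha>) n) / 2)"
    (is "?l = bernoulli_pmf ?r")
proof -
  let ?D = "mass \<alpha> (child_weight m \<alpha>) n"
  have D: "?D > 0" by (rule mass_pos[OF assms(1,2)])
  have r: "0 \<le> ?r" "?r \<le> 1"
    using weighted_color_sum_bound[OF assms] D by (auto simp: field_simps abs_le_iff)
  have col: "1 + of_int (B 1) * of_int (B v) = (if B v = B 1 then 2 else (0 :: real))" if "v \<in> {1..n}" for v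
  proof -
    have "B v \<in> {-1, 1}" "B 1 \<in> {-1, 1}" using assms(2) that by (simp_all only: colors_okD[OF assms(4)] atLeastAtMost_iff order_refl)
    thus ?thesis by auto
  qed
  have "pmf ?l True = measure_pmf.prob (attachment m \<alpha> n p) {v. B v = B 1}"
    by (simp add: pmf_map vimage_def)
  also have "\<dots> = measure_pmf.prob (attachment m \<alpha> n p) {v \<in> {1..n}. B v = B 1}"
    using set_attachment[OF assms(1-3)] by (intro measure_eq_AE) (auto simp: AE_measure_pmf_iff)
  also have "\<dots> = (\<Sum>v\<in>{v \<in> {1..n}. B v = B 1}. attach_prob m \<alpha> n p v)"
    by (subst measure_measure_pmf_finite) (auto simp: pmf_attachment_aux[OF assms(1-3)])
  also have "\<dots> = (\<Sum>v\<in>{1..n}. if B v = B 1 then attach_prob m \<alpha> n p v else 0)"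
    by (rule sum.inter_filter) simp
  also have "\<dots> = (\<Sum>v\<in>{1..n}. attach_prob m \<alpha> n p v * (1 + of_int (B 1) * of_int (B v)) / 2)"
    by (intro sum.cong refl) (simp only: col, simp)
  also have "\<dots> = ((\<Sum>v\<in>{1..n}. attach_prob m \<alpha> n p v) + of_int (B 1) * (\<Sum>v\<in>{1..n}. attach_prob m \<alpha> n p v * of_int (B v))) / 2"
    by (simp add: sum_divide_distrib[symmetric] sum.distrib sum_distrib_left distrib_left mult_ac)
  also have "(\<Sum>v\<in>{1..n}. attach_prob m \<alpha> n p v) = 1"
    using sum_attach_prob assms by (simp add: attachable_def)
  also have "of_int (B 1) * (\<Sum>v\<in>{1..n}. attach_prob m \<alpha> n p v * of_int (B v)) = weighted_color_sum m \<alpha> n p B / ?D"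
    by (simp add: weighted_color_sum_def attach_prob_eq_weight sum_divide_distrib sum_distrib_left)
  finally have T: "pmf ?l True = pmf (bernoulli_pmf ?r) True" using r by simp
  have "pmf ?l False = 1 - pmf ?l True" "pmf (bernoulli_pmf ?r) False = 1 - pmf (bernoulli_pmf ?r) True"
    by (simp_all add: pmf_False_conv_True)
  with T have "pmf ?l b = pmf (bernoulli_pmf ?r) b" for b by (cases b) simp_all
  thus ?thesis by (rule pmf_eqI)
qed

lemma urn_state_Suc:
  assumes "n \<ge> 1" "is_tree n p" "colors_ok n B" "v \<in> {1..n}"
  shows "urn_state m \<alpha> (Suc n) (p(Suc n := v), B(Suc n := (if flip then - B v else B v)))
    = (color_sum n B + spin (\<not> flip) * spin (B v = B 1),
       weighted_color_sum m \<alpha> n p B + (\<alpha> + child_weight m \<alpha> * spin (\<not> flip)) * spin (B v = B 1))"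
proof -
  let ?B = "B(Suc n := (if flip then - B v else B v))" and ?p = "p(Suc n := v)"
  have col: "real_of_int (B 1) * of_int (B v) = spin (B v = B 1)"
  proof -
    have "B v \<in> {-1, 1}" "B 1 \<in> {-1, 1}" using assms(1,4) by (simp_all only: colors_okD[OF assms(3)] atLeastAtMost_iff order_refl)
    thus ?thesis by (auto simp: spin_def)
  qed
  have new: "real_of_int (?B (Suc n)) = spin (\<not> flip) * of_int (B v)" by (simp add: spin_def)
  have B1: "?B 1 = B 1" using assms(1) by simp
  have "color_sum (Suc n) ?B = of_int (B 1) * ((\<Sum>v\<in>{1..n}. of_int (?B v)) + of_int (?B (Suc n)))"
    unfolding color_sum_def B1 by (simp del: fun_upd_apply)
  also have "(\<Sum>v\<in>{1..n}. real_of_int (?B v)) = (\<Sum>v\<in>{1..n}. of_int (B v))" by (intro sum.cong) auto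
  also have "of_int (B 1) * ((\<Sum>v\<in>{1..n}. of_int (B v)) + of_int (?B (Suc n)))
      = color_sum n B + spin (\<not> flip) * (of_int (B 1) * of_int (B v))"
    unfolding new by (simp add: color_sum_def distrib_left mult_ac)
  finally have 1: "color_sum (Suc n) ?B = color_sum n B + spin (\<not> flip) * spin (B v = B 1)"
    unfolding col .
  have w: "weight m \<alpha> (Suc n) ?p w = (if w = Suc n then child_weight m \<alpha> else weight m \<alpha> n p w + (if w = v then \<alpha> else 0))"
    if "w \<in> {1..Suc n}" for w by (rule attach_weight_step[OF assms(2,4) that])
  have "weighted_color_sum m \<alpha> (Suc n) ?p ?B
     = of_int (B 1) * ((\<Sum>w\<in>{1..n}. weight m \<alpha> (Suc n) ?p w * of_int (?B w)) + weight m \<alpha> (Suc n) ?p (Suc n) * of_int (?B (Suc n)))"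
    unfolding weighted_color_sum_def B1 by (simp del: fun_upd_apply)
  also have "(\<Sum>w\<in>{1..n}. weight m \<alpha> (Suc n) ?p w * of_int (?B w))
     = (\<Sum>w\<in>{1..n}. weight m \<alpha> n p w * of_int (B w) + (if w = v then \<alpha> * of_int (B w) else 0))"
    using w by (intro sum.cong refl) (simp add: distrib_right)
  also have "\<dots> = (\<Sum>w\<in>{1..n}. weight m \<alpha> n p w * of_int (B w)) + \<alpha> * of_int (B v)"
    using assms(4) by (simp add: sum.distrib)
  also have "weight m \<alpha> (Suc n) ?p (Suc n) = child_weight m \<alpha>" using w[of "Suc n"] by simp
  also have "of_int (B 1) * ((\<Sum>w\<in>{1..n}. weight m \<alpha> n p w * of_int (B w)) + \<alpha> * of_int (B v)
        + child_weight m \<alpha> * of_int (?B (Suc n)))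
      = weighted_color_sum m \<alpha> n p B + (\<alpha> + child_weight m \<alpha> * spin (\<not> flip)) * (of_int (B 1) * of_int (B v))"
    unfolding new by (simp add: weighted_color_sum_def distrib_left distrib_right mult_ac add_ac)
  finally have 2: "weighted_color_sum m \<alpha> (Suc n) ?p ?B
      = weighted_color_sum m \<alpha> n p B + (\<alpha> + child_weight m \<alpha> * spin (\<not> flip)) * spin (B v = B 1)"
    unfolding col .
  show ?thesis using 1 2 by (simp add: urn_state_def)
qed

text \<open>Although the tree itself evolves in a complicated way, the law of the next state depends only on the
present state, because the parent enters \<open>urn_state_Suc\<close> only through its color.\<close>

lemma urn_Suc:
  assumes \<alpha>: "\<alpha> \<in> allowed_params m" and n: "n \<ge> 1"
  shows "urn m \<alpha> q (Suc n) = urn m \<alpha> q n \<bind> urn_step \<alpha> (child_weight m \<alpha>) q n"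
proof -
  have "urn m \<alpha> q (Suc n) = broadcast m \<alpha> q n \<bind> (\<lambda>(p, B). attachment m \<alpha> n p \<bind> (\<lambda>v. bernoulli_pmf q \<bind>
      (\<lambda>flip. return_pmf (urn_state m \<alpha> (Suc n) (p(Suc n := v), B(Suc n := (if flip then - B v else B v)))))))"
    unfolding urn_def broadcast_Suc[OF n] by (auto simp: map_bind_pmf intro!: bind_pmf_cong)
  also have "\<dots> = broadcast m \<alpha> q n \<bind> (\<lambda>x. urn_step \<alpha> (child_weight m \<alpha>) q n (urn_state m \<alpha> n x))"
  proof (rule bind_pmf_cong[OF refl])
    fix x assume "x \<in> set_pmf (broadcast m \<alpha> q n)"
    moreover obtain p B where x: "x = (p, B)" by (cases x)
    ultimately have pB: "(p, B) \<in> set_pmf (broadcast m \<alpha> q n)" by simp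
    note att = attachable_broadcast[OF \<alpha> n pB] and col = colors_ok_broadcast[OF \<alpha> n pB]
    have tree: "is_tree n p" using att by (simp add: attachable_def)
    define y w where "y = color_sum n B" and "w = weighted_color_sum m \<alpha> n p B"
    define H where "H = (\<lambda>b flip. return_pmf (y + spin (\<not> flip) * spin b, w + (\<alpha> + child_weight m \<alpha> * spin (\<not> flip)) * spin b))"
    have "attachment m \<alpha> n p \<bind> (\<lambda>v. bernoulli_pmf q \<bind>
        (\<lambda>flip. return_pmf (urn_state m \<alpha> (Suc n) (p(Suc n := v), B(Suc n := (if flip then - B v else B v))))))
      = attachment m \<alpha> n p \<bind> (\<lambda>v. bernoulli_pmf q \<bind> H (B v = B 1))"
      unfolding H_def y_def w_def using set_attachment[OF \<alpha> n att]
      by (intro bind_pmf_cong refl) (subst urn_state_Suc[OF n tree col], auto)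
    also have "\<dots> = map_pmf (\<lambda>v. B v = B 1) (attachment m \<alpha> n p) \<bind> (\<lambda>b. bernoulli_pmf q \<bind> H b)"
      by (simp add: bind_map_pmf)
    also have "\<dots> = urn_step \<alpha> (child_weight m \<alpha>) q n (y, w)"
      unfolding relative_color_of_parent[OF \<alpha> n att col] w_def[symmetric]
      by (simp add: urn_step_def bind_map_pmf H_def)
    finally show "(case x of (p, B) \<Rightarrow> attachment m \<alpha> n p \<bind> (\<lambda>v. bernoulli_pmf q \<bind>
        (\<lambda>flip. return_pmf (urn_state m \<alpha> (Suc n) (p(Suc n := v), B(Suc n := (if flip then - B v else B v)))))))
      = urn_step \<alpha> (child_weight m \<alpha>) q n (urn_state m \<alpha> n x)"
      by (simp add: x urn_state_def y_def w_def)
  qed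
  also have "\<dots> = urn m \<alpha> q n \<bind> urn_step \<alpha> (child_weight m \<alpha>) q n"
    by (simp add: urn_def bind_map_pmf)
  finally show ?thesis .
qed

lemma urn_1: "urn m \<alpha> q 1 = return_pmf (1, 1)"
proof -
  have w: "weight m \<alpha> (Suc 0) p (Suc 0) = 1" for p
    by (cases m) (auto simp: outdeg_def deg_def adj_def)
  have "urn m \<alpha> q 1 = pmf_of_set {-1, 1} \<bind> (\<lambda>b. return_pmf (urn_state m \<alpha> 1 (\<lambda>_. 0, (\<lambda>_. 0)(1 := b))))"
    by (simp add: urn_def map_bind_pmf)
  also have "\<dots> = pmf_of_set {-1, 1 :: int} \<bind> (\<lambda>b. return_pmf (1, 1))"
    by (intro bind_pmf_cong refl)
       (auto simp: urn_state_def color_sum_def weighted_color_sum_def w)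
  finally show ?thesis by simp
qed

text \<open>A tie is resolved by a fair coin, and it is counted in exactly one of the two probabilities.\<close>

lemma R_maj_at_eq:
  assumes \<alpha>: "\<alpha> \<in> allowed_params m" and N: "N \<ge> 1"
  shows "R_maj_at m \<alpha> N q =
    (measure_pmf.prob (urn m \<alpha> q N) {s. fst s < 0} + measure_pmf.prob (urn m \<alpha> q N) {s. fst s \<le> 0}) / 2"
proof -
  let ?P = "broadcast m \<alpha> q N"
  define Y where "Y = (\<lambda>x :: (nat \<Rightarrow> nat) \<times> (nat \<Rightarrow> int). color_sum N (snd x))"
  define J where "J = (\<lambda>x :: (nat \<Rightarrow> nat) \<times> (nat \<Rightarrow> int). pmf_of_set {-1, 1 :: int} \<bind> (\<lambda>tie. let S = \<Sum>u\<in>{1..N}. snd x u in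
      return_pmf (if S \<noteq> 0 then sgn S else tie, snd x 1)))"
  let ?E = "{(b, root). b \<noteq> root} :: (int \<times> int) set"
  have J: "measure_pmf.prob (J x) ?E = (indicator {x. Y x < 0} x + indicator {x. Y x \<le> 0} x) / 2"
    if "x \<in> set_pmf ?P" for x
  proof -
    obtain p B where x: "x = (p, B)" by (cases x)
    define S where "S = (\<Sum>u\<in>{1..N}. B u)"
    have B1: "B 1 \<in> {-1, 1}"
      using colors_ok_broadcast[OF \<alpha> N, of p B q] that N by (intro colors_okD) (auto simp: x)
    have Y: "Y x = of_int (B 1 * S)" by (simp add: Y_def x color_sum_def S_def)
    have Jx: "J x = map_pmf (\<lambda>tie. (if S \<noteq> 0 then sgn S else tie, B 1)) (pmf_of_set {-1, 1})"
      by (simp only: J_def x S_def Let_def map_pmf_def snd_conv)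
    show ?thesis
    proof (cases "S = 0")
      case True
      have "{-1, 1} \<inter> {tie. tie \<noteq> B 1} = {- B 1}" using B1 by auto
      thus ?thesis using True B1 by (simp add: Jx Y vimage_def measure_pmf_of_set)
    next
      case False
      have sgn: "(b * S < 0 \<longleftrightarrow> sgn S \<noteq> b) \<and> (b * S \<le> 0 \<longleftrightarrow> sgn S \<noteq> b)" if "b \<in> {-1, 1}" for b :: int
        using False that by (auto simp: sgn_if)
      have "Y x < 0 \<longleftrightarrow> sgn S \<noteq> B 1" "Y x \<le> 0 \<longleftrightarrow> sgn S \<noteq> B 1"
        unfolding Y of_int_less_0_iff of_int_le_0_iff using False sgn[OF B1] by blast+
      thus ?thesis using False by (simp add: Jx vimage_def indicator_def)
    qed
  qed
  have "R_maj_at m \<alpha> N q = measure_pmf.prob (?P \<bind> J) ?E"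
    by (simp only: R_maj_at_def majority_def J_def split_def Let_def)
  also have "\<dots> = measure_pmf.expectation ?P (\<lambda>x. measure_pmf.prob (J x) ?E)"
    unfolding measure_pmf_bind
    using measurable_measure_pmf[of J]
    by (intro measure_pmf.measure_bind[where N = "count_space UNIV"]) auto
  also have "\<dots> = measure_pmf.expectation ?P (\<lambda>x. (indicator {x. Y x < 0} x + indicator {x. Y x \<le> 0} x) / 2)"
    using J by (intro integral_cong_AE) (auto simp: AE_measure_pmf_iff)
  also have "\<dots> = (measure_pmf.prob ?P {x. Y x < 0} + measure_pmf.prob ?P {x. Y x \<le> 0}) / 2"
    by (simp, subst Bochner_Integration.integral_add)
       (auto intro!: measure_pmf.integrable_const_bound[where B = 1] simp: indicator_def)
  also have "\<dots> = (measure_pmf.prob (urn m \<alpha> q N) {s. fst s < 0} + measure_pmf.prob (urn m \<alpha> q N) {s. fst s \<le> 0}) / 2"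
    by (simp add: urn_def vimage_def urn_state_def Y_def case_prod_beta)
  finally show ?thesis .
qed


text \<open>The threshold enters here: with \<open>\<beta> = child_weight m \<alpha>\<close>, the condition \<open>2 * (\<alpha> + \<beta> * (1 - 2 * q)) \<le> \<alpha> + \<beta>\<close>
says that \<open>4 * \<beta> * q \<ge> \<alpha> + \<beta>\<close>, which is \<open>q \<ge> threshold m \<alpha>\<close> in both models.\<close>

lemma two_color_urn_urn:
  assumes \<alpha>: "\<alpha> \<in> allowed_params m" and q: "q \<in> {0..1}" "q \<ge> threshold m \<alpha>"
  shows "two_color_urn \<alpha> (child_weight m \<alpha>) q (urn m \<alpha> q)"
proof
  show "0 \<le> q" "q \<le> 1" using q by auto
  have \<alpha>0: "\<alpha> \<ge> - 1 / 2" and \<alpha>3: "m = Shape_Exchangeable \<Longrightarrow> \<alpha> \<ge> - 1 / 3"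
    using \<alpha> by (auto elim!: allowed_cases simp: field_simps)
  show pos: "\<alpha> + child_weight m \<alpha> > 0"
    using \<alpha>0 \<alpha>3 by (cases m) auto
  have beta: "child_weight m \<alpha> \<ge> 0" using \<alpha>0 by (cases m) auto
  have "child_weight m \<alpha> * (1 - 2 * q) \<ge> child_weight m \<alpha> * (- 1)"
    using beta q by (intro mult_left_mono) auto
  thus "- 2 \<le> \<alpha> + child_weight m \<alpha> * (1 - 2 * q)" using \<alpha>0 by (cases m) auto
  have "\<alpha> + child_weight m \<alpha> \<le> 4 * (child_weight m \<alpha> * q)"
  proof (cases m)
    case Very_Simple_Increasing
    thus ?thesis using q by simp
  next
    case Shape_Exchangeable
    hence "(2 * \<alpha> + 1) / (4 * (\<alpha> + 1)) \<le> q" using q by simp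
    moreover have "4 * (\<alpha> + 1) > 0" using \<alpha>0 by simp
    ultimately have "2 * \<alpha> + 1 \<le> q * (4 * (\<alpha> + 1))" by (simp only: pos_divide_le_eq)
    thus ?thesis using Shape_Exchangeable by (simp add: algebra_simps)
  qed
  thus "2 * (\<alpha> + child_weight m \<alpha> * (1 - 2 * q)) \<le> \<alpha> + child_weight m \<alpha>"
    by (simp add: algebra_simps)
  show "urn m \<alpha> q 1 = return_pmf (1, 1)" by (rule urn_1)
  show "urn m \<alpha> q (Suc n) = urn m \<alpha> q n \<bind> urn_step \<alpha> (child_weight m \<alpha>) q n" if "n \<ge> 1" for n
    by (rule urn_Suc[OF \<alpha> that])
  show "\<bar>w\<bar> \<le> mass \<alpha> (child_weight m \<alpha>) n" if n: "n \<ge> 1" and w: "(y, w) \<in> set_pmf (urn m \<alpha> q n)" for n y w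
  proof -
    from w obtain p B where pB: "(p, B) \<in> set_pmf (broadcast m \<alpha> q n)" and "w = weighted_color_sum m \<alpha> n p B"
      by (auto simp: urn_def urn_state_def)
    thus ?thesis
      using weighted_color_sum_bound[OF \<alpha> n attachable_broadcast[OF \<alpha> n pB] colors_ok_broadcast[OF \<alpha> n pB]] by simp
  qed
qed

section \<open>Error probability of the majority estimator\<close>

theorem theorem2p1:
  fixes m :: tree_model and \<alpha> q :: real
  assumes "\<alpha> \<in> allowed_params m"
    and "q \<in> {0..1}"
    and "q \<ge> threshold m \<alpha>"
  shows "R_maj m \<alpha> q = 1 / 2"
proof -
  interpret two_color_urn \<alpha> "child_weight m \<alpha>" q "urn m \<alpha> q"
    by (rule two_color_urn_urn[OF assms])
  have "eventually (\<lambda>N. (measure_pmf.prob (urn m \<alpha> q N) {s. fst s < 0} + measure_pmf.prob (urn m \<alpha> q N) {s. fst s \<le> 0}) / 2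
      = R_maj_at m \<alpha> N q) sequentially"
    using eventually_ge_at_top[of 1] by eventually_elim (simp only: R_maj_at_eq[OF assms(1)])
  with sign_forgets_start have "(\<lambda>N. R_maj_at m \<alpha> N q) \<longlonglongrightarrow> 1 / 2"
    by (rule Lim_transform_eventually)
  hence "(\<lambda>N. ereal (R_maj_at m \<alpha> N q)) \<longlonglongrightarrow> ereal (1 / 2)" by (rule tendsto_ereal)
  hence "R_maj m \<alpha> q = ereal (1 / 2)"
    unfolding R_maj_def by (intro lim_imp_Limsup) simp_all
  thus ?thesis by (simp add: numeral_eq_ereal one_ereal_def)
qed

end
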